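(* Let $L$ be a countable first-order language, $n\ge1$, and let $T$ be a complete theory in $L$ such that $\alpha_n(T)\le\aleph_0$. An $n$-generated model $\mathcal M$ of $T$ is prime if and only if there exists an $L$-formula $\theta(\bar x)$ (with $\bar x$ a finite tuple of variables), satisfied by some tuple in $\mathcal M$, such that whenever $\mathcal M\models\theta(\bar a)$, the tuple $\bar a$ generates $\mathcal M$.
   Context: A tuple $\bar a$ generates $\mathcal M$ if every element of $\mathcal M$ equals $\tau(\bar a)$ for some $L$-term $\tau(\bar x)$; $\mathcal M$ is $n$-generated if it is generated by some $n$-tuple. $\alpha_n(T)$ is the number of $n$-generated models of $T$ up to isomorphism. $\mathcal M$ is prime if it is a prime model of its complete theory, i.e. it embeds elementarily into every model of its complete theory. *)

theory Defs
  imports Main "HOL-Library.Countable_Set" "HOL-Library.Infinite_Typeclass"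
begin

unbundle cardinal_syntax

text \<open>
  First-order logic with equality. The symbols of a language form sets rather than whole types,
  so that languages without function symbols are covered; constants are function symbols of
  arity 0. Arities of symbols outside the language are irrelevant.
\<close>

record ('f, 'r) lang =
  Funs :: "'f set"
  Rels :: "'r set"
  farity :: "'f \<Rightarrow> nat"
  rarity :: "'r \<Rightarrow> nat"

definition countable_lang :: "('f, 'r) lang \<Rightarrow> bool" where
  "countable_lang L \<longleftrightarrow> countable (Funs L) \<and> countable (Rels L)"

datatype 'f tm = Var nat | App 'f "'f tm list"

datatype ('f, 'r) fm =
    Eq "'f tm" "'f tm"
  | Rel 'r "'f tm list"
  | Neg "('f, 'r) fm"
  | Conj "('f, 'r) fm" "('f, 'r) fm"
  | Ex nat "('f, 'r) fm"

fun is_term :: "('f, 'r) lang \<Rightarrow> 'f tm \<Rightarrow> bool" where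
  "is_term L (Var i) \<longleftrightarrow> True"
| "is_term L (App f ts) \<longleftrightarrow>
     f \<in> Funs L \<and> length ts = farity L f \<and> (\<forall>t \<in> set ts. is_term L t)"

primrec is_formula :: "('f, 'r) lang \<Rightarrow> ('f, 'r) fm \<Rightarrow> bool" where
  "is_formula L (Eq s t) \<longleftrightarrow> is_term L s \<and> is_term L t"
| "is_formula L (Rel r ts) \<longleftrightarrow>
     r \<in> Rels L \<and> length ts = rarity L r \<and> (\<forall>t \<in> set ts. is_term L t)"
| "is_formula L (Neg \<phi>) \<longleftrightarrow> is_formula L \<phi>"
| "is_formula L (Conj \<phi> \<psi>) \<longleftrightarrow> is_formula L \<phi> \<and> is_formula L \<psi>"
| "is_formula L (Ex i \<phi>) \<longleftrightarrow> is_formula L \<phi>"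

fun tvars :: "'f tm \<Rightarrow> nat set" where
  "tvars (Var i) = {i}"
| "tvars (App f ts) = (\<Union>t \<in> set ts. tvars t)"

primrec fvars :: "('f, 'r) fm \<Rightarrow> nat set" where
  "fvars (Eq s t) = tvars s \<union> tvars t"
| "fvars (Rel r ts) = (\<Union>t \<in> set ts. tvars t)"
| "fvars (Neg \<phi>) = fvars \<phi>"
| "fvars (Conj \<phi> \<psi>) = fvars \<phi> \<union> fvars \<psi>"
| "fvars (Ex i \<phi>) = fvars \<phi> - {i}"

definition is_sentence :: "('f, 'r) lang \<Rightarrow> ('f, 'r) fm \<Rightarrow> bool" where
  "is_sentence L \<phi> \<longleftrightarrow> is_formula L \<phi> \<and> fvars \<phi> = {}"

text \<open>
  The underlying set of a structure is a nonempty subset of a type \<open>'u\<close>. The interpretations are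
  total HOL functions; only their values on symbols of the language and on tuples of the right
  length from the underlying set matter.
\<close>

record ('u, 'f, 'r) struct =
  Dom :: "'u set"
  fint :: "'f \<Rightarrow> 'u list \<Rightarrow> 'u"
  rint :: "'r \<Rightarrow> 'u list \<Rightarrow> bool"

definition tuples :: "('u, 'f, 'r) struct \<Rightarrow> nat \<Rightarrow> 'u list set" where
  "tuples M n = {a. length a = n \<and> set a \<subseteq> Dom M}"

definition is_struct :: "('f, 'r) lang \<Rightarrow> ('u, 'f, 'r) struct \<Rightarrow> bool" where
  "is_struct L M \<longleftrightarrow>
     Dom M \<noteq> {} \<and> (\<forall>f \<in> Funs L. \<forall>a \<in> tuples M (farity L f). fint M f a \<in> Dom M)"

primrec tval :: "('u, 'f, 'r) struct \<Rightarrow> (nat \<Rightarrow> 'u) \<Rightarrow> 'f tm \<Rightarrow> 'u" where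
  "tval M s (Var i) = s i"
| "tval M s (App f ts) = fint M f (map (tval M s) ts)"

primrec sat :: "('u, 'f, 'r) struct \<Rightarrow> (nat \<Rightarrow> 'u) \<Rightarrow> ('f, 'r) fm \<Rightarrow> bool" where
  "sat M s (Eq t u) \<longleftrightarrow> tval M s t = tval M s u"
| "sat M s (Rel r ts) \<longleftrightarrow> rint M r (map (tval M s) ts)"
| "sat M s (Neg \<phi>) \<longleftrightarrow> \<not> sat M s \<phi>"
| "sat M s (Conj \<phi> \<psi>) \<longleftrightarrow> sat M s \<phi> \<and> sat M s \<psi>"
| "sat M s (Ex i \<phi>) \<longleftrightarrow> (\<exists>x \<in> Dom M. sat M (s(i := x)) \<phi>)"

text \<open>
  A tuple \<open>a\<close> of length \<open>m\<close> is read as an assignment to the variables \<open>0, \<dots>, m - 1\<close>. Values at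
  other variables are arbitrary: the assignment is only used for terms and formulas whose (free)
  variables are among \<open>0, \<dots>, m - 1\<close>.
\<close>

definition asg :: "'u list \<Rightarrow> nat \<Rightarrow> 'u" where
  "asg a = (\<lambda>i. if i < length a then a ! i else undefined)"

definition models_sentence :: "('u, 'f, 'r) struct \<Rightarrow> ('f, 'r) fm \<Rightarrow> bool" where
  "models_sentence M \<phi> \<longleftrightarrow> (\<forall>s. range s \<subseteq> Dom M \<longrightarrow> sat M s \<phi>)"

definition is_model :: "('f, 'r) lang \<Rightarrow> ('f, 'r) fm set \<Rightarrow> ('u, 'f, 'r) struct \<Rightarrow> bool" where
  "is_model L T M \<longleftrightarrow> is_struct L M \<and> (\<forall>\<phi> \<in> T. models_sentence M \<phi>)"

text \<open>
  HOL cannot quantify over the models on all types inside a formula, so each notion below that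
  refers to all models takes a type as a parameter and ranges over the models whose underlying set
  is contained in that type. The sort \<open>infinite\<close> ensures that every countable structure has an
  isomorphic copy on the type; for a countable language, by Loewenheim-Skolem, satisfiability and
  consequence of a set of sentences then do not depend on the type.
\<close>

definition complete_theory ::
  "'u::infinite itself \<Rightarrow> ('f, 'r) lang \<Rightarrow> ('f, 'r) fm set \<Rightarrow> bool" where
  "complete_theory _ L T \<longleftrightarrow>
     (\<forall>\<phi> \<in> T. is_sentence L \<phi>) \<and>
     (\<exists>M :: ('u, 'f, 'r) struct. is_model L T M) \<and>
     (\<forall>\<phi>. is_sentence L \<phi> \<longrightarrow>
        (\<forall>M :: ('u, 'f, 'r) struct. is_model L T M \<longrightarrow> models_sentence M \<phi>) \<or>
        (\<forall>M :: ('u, 'f, 'r) struct. is_model L T M \<longrightarrow> models_sentence M (Neg \<phi>)))"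

definition Th :: "('f, 'r) lang \<Rightarrow> ('u, 'f, 'r) struct \<Rightarrow> ('f, 'r) fm set" where
  "Th L M = {\<phi>. is_sentence L \<phi> \<and> models_sentence M \<phi>}"

definition generates :: "('f, 'r) lang \<Rightarrow> ('u, 'f, 'r) struct \<Rightarrow> 'u list \<Rightarrow> bool" where
  "generates L M a \<longleftrightarrow>
     set a \<subseteq> Dom M \<and>
     (\<forall>x \<in> Dom M. \<exists>\<tau>. is_term L \<tau> \<and> tvars \<tau> \<subseteq> {..<length a} \<and> x = tval M (asg a) \<tau>)"

definition n_generated :: "('f, 'r) lang \<Rightarrow> nat \<Rightarrow> ('u, 'f, 'r) struct \<Rightarrow> bool" where
  "n_generated L n M \<longleftrightarrow> (\<exists>a \<in> tuples M n. generates L M a)"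

definition is_isomorphism ::
  "('f, 'r) lang \<Rightarrow> ('u, 'f, 'r) struct \<Rightarrow> ('v, 'f, 'r) struct \<Rightarrow> ('u \<Rightarrow> 'v) \<Rightarrow> bool" where
  "is_isomorphism L M N h \<longleftrightarrow>
     bij_betw h (Dom M) (Dom N) \<and>
     (\<forall>f \<in> Funs L. \<forall>a \<in> tuples M (farity L f). h (fint M f a) = fint N f (map h a)) \<and>
     (\<forall>r \<in> Rels L. \<forall>a \<in> tuples M (rarity L r). rint M r a \<longleftrightarrow> rint N r (map h a))"

definition n_gen_models ::
  "('f, 'r) lang \<Rightarrow> ('f, 'r) fm set \<Rightarrow> nat \<Rightarrow> ('u, 'f, 'r) struct set" where
  "n_gen_models L T n = {M. is_model L T M \<and> n_generated L n M}"

definition iso_rel ::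
  "('f, 'r) lang \<Rightarrow> (('u, 'f, 'r) struct \<times> ('u, 'f, 'r) struct) set" where
  "iso_rel L = {(M, N). is_struct L M \<and> is_struct L N \<and> (\<exists>h. is_isomorphism L M N h)}"

text \<open>
  The number of isomorphism classes, as a cardinal. For a countable language all \<open>n\<close>-generated
  models are countable, so each of them is represented on the infinite type \<open>'u\<close>.
\<close>

definition alpha ::
  "'u::infinite itself \<Rightarrow> ('f, 'r) lang \<Rightarrow> nat \<Rightarrow> ('f, 'r) fm set \<Rightarrow> ('u, 'f, 'r) struct set rel" where
  "alpha _ L n T = |(n_gen_models L T n :: ('u, 'f, 'r) struct set) // iso_rel L|"

definition elementary_embedding ::
  "('f, 'r) lang \<Rightarrow> ('u, 'f, 'r) struct \<Rightarrow> ('v, 'f, 'r) struct \<Rightarrow> ('u \<Rightarrow> 'v) \<Rightarrow> bool" where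
  "elementary_embedding L M N h \<longleftrightarrow>
     h ` Dom M \<subseteq> Dom N \<and>
     (\<forall>\<phi> s. is_formula L \<phi> \<and> range s \<subseteq> Dom M \<longrightarrow> (sat M s \<phi> \<longleftrightarrow> sat N (h \<circ> s) \<phi>))"

text \<open>
  The type \<open>'v\<close> of the models into which \<open>M\<close> has to embed need not be the type \<open>'u\<close> of \<open>M\<close>. For a
  countable language and any infinite \<open>'v\<close> this is again equivalent to embedding into the models
  on all types.
\<close>

definition prime_model ::
  "'v::infinite itself \<Rightarrow> ('f, 'r) lang \<Rightarrow> ('u, 'f, 'r) struct \<Rightarrow> bool" where
  "prime_model _ L M \<longleftrightarrow>
     is_struct L M \<and>
     (\<forall>N :: ('v, 'f, 'r) struct. is_model L (Th L M) N \<longrightarrow> (\<exists>h. elementary_embedding L M N h))"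

end

theory Submission
  imports Defs "HOL-Library.Countable_Set_Type"
begin

text \<open>
  \<^bold>\<open>Prime implies such a formula.\<close> Let \<open>g\<close> be a generating tuple. A prime model realises only isolated
  types, because a non-isolated type is omitted in some model of the theory
  (\<open>omitting_non_isolated_type\<close>); so one formula \<open>\<phi>\<close> implies the complete type of \<open>g\<close>
  (\<open>prime_isolates\<close>). This \<open>\<phi>\<close> is the formula sought. If \<open>b\<close> satisfies \<open>\<phi>\<close>, then \<open>b\<close> has the type
  of \<open>g\<close> and \<open>b = \<sigma>(g)\<close> for some terms \<open>\<sigma>\<close>. Since \<open>b\<close> satisfies \<open>\<exists>x. \<phi>(x) \<and> b = \<sigma>(x)\<close>, so does \<open>g\<close>:
  there is \<open>g'\<close> of the same type with \<open>g = \<sigma>(g')\<close>. Writing \<open>g' = \<rho>(g)\<close> gives \<open>g' = \<rho>(\<sigma>(g'))\<close>,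
  a statement about the common type, so \<open>g = \<rho>(\<sigma>(g)) = \<rho>(b)\<close> and \<open>b\<close> generates. This replaces the
  back-and-forth argument for an automorphism taking \<open>g\<close> to \<open>b\<close> (\<open>complete_formula_spans\<close>).

  \<^bold>\<open>Such a formula implies prime.\<close> Substituting terms in a generating \<open>n\<close>-tuple moves \<open>\<theta>\<close> to \<open>n\<close>
  variables. If some complete formula \<open>\<phi>\<close> lies below \<open>\<theta>\<close>, then a tuple satisfying it
  generates \<open>M\<close>, and sending it to a realisation of \<open>\<phi>\<close> in another model of the complete theory
  of \<open>M\<close> extends to an elementary embedding (\<open>prime_if_complete_formula\<close>). Otherwise every
  satisfiable formula below \<open>\<theta>\<close> splits. Then, by a Baire category argument, any countable set of
  complete \<open>n\<close>-types is avoided by a type below \<open>\<theta>\<close> all of whose existential formulas are witnessed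
  by terms in the \<open>n\<close> variables; the witnesses exist because every tuple of \<open>M\<close> satisfying \<open>\<theta>\<close>
  generates \<open>M\<close>. Such a type is realised by a generating tuple of an \<open>n\<close>-generated model
  (\<open>new_generated_model\<close>). But countably many countable models realise only countably many types,
  which contradicts \<open>\<alpha>\<^sub>n(T) \<le> \<aleph>\<^sub>0\<close>.

  \<^bold>\<open>The construction of models.\<close> Both models above come from one construction. A descending
  sequence of formulas satisfiable in \<open>M\<close>, chosen to meet countably many dense sets of formulas,
  yields a filter \<open>F\<close> on the assignments into \<open>M\<close>, and terms modulo \<open>F\<close>-almost everywhere equality
  form a model in which exactly the \<open>F\<close>-almost everywhere true formulas hold (\<open>term_model\<close>). For the
  omitted type the terms range over all variables, and unused variables serve as witnesses; for the
  generated model they range over \<open>n\<close> variables.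
\<close>

section \<open>Terms, assignments and substitution\<close>

lemma tval_cong:
  "(\<And>i. i \<in> tvars t \<Longrightarrow> s i = s' i) \<Longrightarrow> tval M s t = tval M s' t"
proof (induction t)
  case (App f ts)
  then have "map (tval M s) ts = map (tval M s') ts"
    by (intro map_cong) auto
  then show ?case by (metis tval.simps(2))
qed simp

lemma sat_cong:
  "(\<And>i. i \<in> fvars \<phi> \<Longrightarrow> s i = s' i) \<Longrightarrow> sat M s \<phi> \<longleftrightarrow> sat M s' \<phi>"
proof (induction \<phi> arbitrary: s s')
  case (Eq t u)
  then show ?case using tval_cong[of t s s' M] tval_cong[of u s s' M] by auto
next
  case (Rel r ts)
  then have "map (tval M s) ts = map (tval M s') ts"
    by (intro map_cong) (auto intro!: tval_cong)
  then show ?case by (metis sat.simps(2))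
next
  case (Neg \<phi>)
  have "sat M s \<phi> \<longleftrightarrow> sat M s' \<phi>"
    by (rule Neg.IH) (use Neg.prems in simp)
  then show ?case by simp
next
  case (Conj \<phi> \<psi>)
  have "sat M s \<phi> \<longleftrightarrow> sat M s' \<phi>" "sat M s \<psi> \<longleftrightarrow> sat M s' \<psi>"
    by (rule Conj.IH; use Conj.prems in simp)+
  then show ?case by simp
next
  case (Ex i \<phi>)
  have "sat M (s(i := x)) \<phi> \<longleftrightarrow> sat M (s'(i := x)) \<phi>" for x
    by (rule Ex.IH) (use Ex.prems in auto)
  then show ?case by simp
qed

definition terms :: "('f, 'r) lang \<Rightarrow> nat set \<Rightarrow> 'f tm set" where
  "terms L V = {t. is_term L t \<and> tvars t \<subseteq> V}"

definition assignments :: "('u, 'f, 'r) struct \<Rightarrow> (nat \<Rightarrow> 'u) set" where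
  "assignments M = {s. range s \<subseteq> Dom M}"

lemma assignmentsD: "s \<in> assignments M \<Longrightarrow> s i \<in> Dom M"
  by (auto simp: assignments_def)

lemma assignments_upd: "s \<in> assignments M \<Longrightarrow> x \<in> Dom M \<Longrightarrow> s(i := x) \<in> assignments M"
  by (auto simp: assignments_def)

lemma tval_in_Dom:
  assumes "is_struct L M" "is_term L t" "s \<in> assignments M"
  shows "tval M s t \<in> Dom M"
  using assms(2)
proof (induction t)
  case (Var i)
  then show ?case using assms(3) by (simp add: assignmentsD)
next
  case (App f ts)
  then have "map (tval M s) ts \<in> tuples M (farity L f)"
    by (auto simp: tuples_def)
  then show ?case using App.prems assms(1) by (simp add: is_struct_def)
qed

primrec tsubst :: "(nat \<Rightarrow> 'f tm) \<Rightarrow> 'f tm \<Rightarrow> 'f tm" where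
  "tsubst \<sigma> (Var i) = \<sigma> i"
| "tsubst \<sigma> (App f ts) = App f (map (tsubst \<sigma>) ts)"

lemma tval_tsubst: "tval M s (tsubst \<sigma> t) = tval M (\<lambda>i. tval M s (\<sigma> i)) t"
proof (induction t)
  case (App f ts)
  then have *: "map (tval M s \<circ> tsubst \<sigma>) ts = map (tval M (\<lambda>i. tval M s (\<sigma> i))) ts"
    by (intro map_cong) auto
  show ?case by (simp only: tsubst.simps tval.simps map_map *)
qed simp

lemma tvars_tsubst: "tvars (tsubst \<sigma> t) = (\<Union>i \<in> tvars t. tvars (\<sigma> i))"
  by (induction t) auto

lemma is_term_tsubst:
  "is_term L t \<Longrightarrow> (\<And>i. i \<in> tvars t \<Longrightarrow> is_term L (\<sigma> i)) \<Longrightarrow> is_term L (tsubst \<sigma> t)"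
  by (induction t) auto

lemma tsubst_in_terms:
  "is_term L t \<Longrightarrow> (\<And>i. i \<in> tvars t \<Longrightarrow> \<sigma> i \<in> terms L V) \<Longrightarrow> tsubst \<sigma> t \<in> terms L V"
  by (auto simp: terms_def tvars_tsubst intro!: is_term_tsubst)

lemma tsubst_Var: "(\<And>i. i \<in> tvars t \<Longrightarrow> \<sigma> i = Var i) \<Longrightarrow> tsubst \<sigma> t = t"
  by (induction t) (auto intro!: map_idI)

lemma finite_tvars: "finite (tvars t)"
  by (induction t) auto

lemma finite_fvars: "finite (fvars \<phi>)"
  by (induction \<phi>) (auto simp: finite_tvars)

definition fresh :: "nat set \<Rightarrow> nat" where
  "fresh A = (SOME j. j \<notin> A)"

lemma fresh: "finite A \<Longrightarrow> fresh A \<notin> A"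
  unfolding fresh_def by (rule someI_ex) (rule ex_new_if_finite[OF infinite_UNIV_nat])

text \<open>
  The bound variable is renamed to one that does not occur in the substituted terms, so no capture
  can happen and \<open>sat_fsubst\<close> holds without side conditions.
\<close>

primrec fsubst :: "(nat \<Rightarrow> 'f tm) \<Rightarrow> ('f, 'r) fm \<Rightarrow> ('f, 'r) fm" where
  "fsubst \<sigma> (Eq t u) = Eq (tsubst \<sigma> t) (tsubst \<sigma> u)"
| "fsubst \<sigma> (Rel r ts) = Rel r (map (tsubst \<sigma>) ts)"
| "fsubst \<sigma> (Neg \<phi>) = Neg (fsubst \<sigma> \<phi>)"
| "fsubst \<sigma> (Conj \<phi> \<psi>) = Conj (fsubst \<sigma> \<phi>) (fsubst \<sigma> \<psi>)"
| "fsubst \<sigma> (Ex i \<phi>) =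
     (let j = fresh (\<Union>k \<in> fvars \<phi> - {i}. tvars (\<sigma> k)) in Ex j (fsubst (\<sigma>(i := Var j)) \<phi>))"

lemma fresh_subst: "k \<in> fvars \<phi> - {i} \<Longrightarrow> fresh (\<Union>k \<in> fvars \<phi> - {i}. tvars (\<sigma> k)) \<notin> tvars (\<sigma> k)"
  using fresh[of "\<Union>k \<in> fvars \<phi> - {i}. tvars (\<sigma> k)"] by (auto simp: finite_tvars finite_fvars)

text \<open>
  The semantic content of renaming a bound variable. It serves for \<open>sat_fsubst\<close> and again for the
  existential step of the truth lemma, where \<open>x\<close> is the value of a witnessing term.
\<close>

lemma sat_fsubst_binder:
  assumes "\<And>k. k \<in> fvars \<phi> - {i} \<Longrightarrow> j \<notin> tvars (\<sigma> k)"
  shows "sat M (\<lambda>k. tval M (s(j := x)) ((\<sigma>(i := Var j)) k)) \<phi> \<longleftrightarrow>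
    sat M ((\<lambda>k. tval M s (\<sigma> k))(i := x)) \<phi>"
proof (rule sat_cong)
  fix k assume k: "k \<in> fvars \<phi>"
  show "tval M (s(j := x)) ((\<sigma>(i := Var j)) k) = ((\<lambda>k. tval M s (\<sigma> k))(i := x)) k"
  proof (cases "k = i")
    case False
    then have "j \<notin> tvars (\<sigma> k)" using assms k by simp
    then have "tval M (s(j := x)) (\<sigma> k) = tval M s (\<sigma> k)"
      by (intro tval_cong) auto
    then show ?thesis using False by simp
  qed simp
qed

lemma sat_fsubst: "sat M s (fsubst \<sigma> \<phi>) \<longleftrightarrow> sat M (\<lambda>i. tval M s (\<sigma> i)) \<phi>"
proof (induction \<phi> arbitrary: \<sigma> s)
  case (Rel r ts)
  have *: "map (tval M s \<circ> tsubst \<sigma>) ts = map (tval M (\<lambda>i. tval M s (\<sigma> i))) ts"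
    by (simp add: tval_tsubst)
  show ?case by (simp only: fsubst.simps sat.simps map_map *)
next
  case (Ex i \<phi>)
  let ?j = "fresh (\<Union>k \<in> fvars \<phi> - {i}. tvars (\<sigma> k))"
  have "sat M (s(?j := x)) (fsubst (\<sigma>(i := Var ?j)) \<phi>) \<longleftrightarrow>
      sat M ((\<lambda>k. tval M s (\<sigma> k))(i := x)) \<phi>" for x
    unfolding Ex.IH by (rule sat_fsubst_binder) (rule fresh_subst)
  then show ?case by (simp add: Let_def)
qed (simp_all add: tval_tsubst)

lemma fvars_fsubst: "fvars (fsubst \<sigma> \<phi>) \<subseteq> (\<Union>i \<in> fvars \<phi>. tvars (\<sigma> i))"
proof (induction \<phi> arbitrary: \<sigma>)
  case (Ex i \<phi>)
  let ?j = "fresh (\<Union>k \<in> fvars \<phi> - {i}. tvars (\<sigma> k))"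
  have "fvars (fsubst (\<sigma>(i := Var ?j)) \<phi>) \<subseteq> (\<Union>k \<in> fvars \<phi>. tvars ((\<sigma>(i := Var ?j)) k))"
    by (rule Ex.IH)
  also have "\<dots> \<subseteq> insert ?j (\<Union>k \<in> fvars \<phi> - {i}. tvars (\<sigma> k))"
    by (auto split: if_splits)
  finally show ?case by (auto simp: Let_def)
next
  case (Conj \<phi> \<psi>)
  then show ?case by (fastforce simp: subset_iff)
qed (auto simp: tvars_tsubst)

lemma is_formula_fsubst:
  "is_formula L \<phi> \<Longrightarrow> (\<And>i. i \<in> fvars \<phi> \<Longrightarrow> is_term L (\<sigma> i)) \<Longrightarrow> is_formula L (fsubst \<sigma> \<phi>)"
  by (induction \<phi> arbitrary: \<sigma>) (auto simp: Let_def intro!: is_term_tsubst)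

definition formulas :: "('f, 'r) lang \<Rightarrow> nat set \<Rightarrow> ('f, 'r) fm set" where
  "formulas L V = {\<phi>. is_formula L \<phi> \<and> fvars \<phi> \<subseteq> V}"

lemma fsubst_in_formulas:
  assumes "is_formula L \<phi>" "\<And>i. i \<in> fvars \<phi> \<Longrightarrow> \<sigma> i \<in> terms L V"
  shows "fsubst \<sigma> \<phi> \<in> formulas L V"
proof -
  have "(\<Union>i \<in> fvars \<phi>. tvars (\<sigma> i)) \<subseteq> V"
    using assms(2) by (auto simp: terms_def)
  then show ?thesis
    using assms fvars_fsubst[of \<sigma> \<phi>]
    by (auto simp: formulas_def terms_def intro!: is_formula_fsubst)
qed

section \<open>Definable images and existential closures\<close>

lemma sat_conj_list:
  "sat M s (foldr Conj \<psi>s \<phi>) \<longleftrightarrow> (\<forall>\<psi> \<in> set \<psi>s. sat M s \<psi>) \<and> sat M s \<phi>"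
  by (induction \<psi>s) auto

lemma fvars_conj_list: "fvars (foldr Conj \<psi>s \<phi>) = (\<Union>\<psi> \<in> set \<psi>s. fvars \<psi>) \<union> fvars \<phi>"
  by (induction \<psi>s) auto

lemma is_formula_conj_list:
  "is_formula L (foldr Conj \<psi>s \<phi>) \<longleftrightarrow> (\<forall>\<psi> \<in> set \<psi>s. is_formula L \<psi>) \<and> is_formula L \<phi>"
  by (induction \<psi>s) auto

lemma sat_ex_list:
  "sat M s (foldr Ex xs \<phi>) \<longleftrightarrow>
    (\<exists>s'. (\<forall>i \<in> set xs. s' i \<in> Dom M) \<and> (\<forall>i. i \<notin> set xs \<longrightarrow> s' i = s i) \<and> sat M s' \<phi>)"
proof (induction xs arbitrary: s)
  case Nil
  have "s' = s" if "\<forall>i. s' i = s i" for s' using that by auto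
  then show ?case by auto
next
  case (Cons x xs)
  show ?case (is "?l \<longleftrightarrow> ?r")
  proof
    assume ?l
    then obtain y s' where "y \<in> Dom M" "\<forall>i \<in> set xs. s' i \<in> Dom M"
      "\<forall>i. i \<notin> set xs \<longrightarrow> s' i = (s(x := y)) i" "sat M s' \<phi>"
      by (auto simp: Cons.IH)
    then show ?r by (intro exI[of _ s']) (metis fun_upd_apply set_ConsD list.set_intros)
  next
    assume ?r
    then obtain s' where s': "\<forall>i \<in> set (x # xs). s' i \<in> Dom M"
      "\<forall>i. i \<notin> set (x # xs) \<longrightarrow> s' i = s i" "sat M s' \<phi>" by blast
    then have "sat M (s(x := s' x)) (foldr Ex xs \<phi>)"
      unfolding Cons.IH by (intro exI[of _ s']) auto
    then show ?l using s' by auto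
  qed
qed

lemma fvars_ex_list: "fvars (foldr Ex xs \<phi>) = fvars \<phi> - set xs"
  by (induction xs) auto

lemma is_formula_ex_list: "is_formula L (foldr Ex xs \<phi>) \<longleftrightarrow> is_formula L \<phi>"
  by (induction xs) auto

text \<open>
  The image of a definable set under a tuple of terms is definable: \<open>\<chi>(y)\<close> is
  \<open>\<exists>z. \<phi>(z) \<and> y = \<sigma>(z)\<close>. The same \<open>\<chi>\<close> works in all structures. To keep \<open>y\<close> and \<open>z\<close> apart, the
  variables of \<open>\<phi>\<close> and \<open>\<sigma>\<close> are shifted by \<open>n\<close>.
\<close>

lemma image_definable:
  assumes \<phi>: "is_formula L \<phi>" and \<sigma>: "\<And>i. i < n \<Longrightarrow> is_term L (\<sigma> i)"
  obtains \<chi> where "\<chi> \<in> formulas L {..<n}"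
    "\<And>(M :: ('u, 'f, 'r) struct) s. s \<in> assignments M \<Longrightarrow> sat M s \<chi> \<longleftrightarrow>
      (\<exists>s' \<in> assignments M. sat M s' \<phi> \<and> (\<forall>i < n. s i = tval M s' (\<sigma> i)))"
proof -
  have "finite (fvars \<phi> \<union> (\<Union>i<n. tvars (\<sigma> i)))"
    by (simp add: finite_fvars finite_tvars)
  then obtain B where B: "fvars \<phi> \<union> (\<Union>i<n. tvars (\<sigma> i)) \<subseteq> {..<B}"
    using finite_nat_iff_bounded by blast
  define \<rho> :: "nat \<Rightarrow> 'f tm" where "\<rho> i = Var (i + n)" for i
  define body where
    "body = foldr Conj (map (\<lambda>i. Eq (Var i) (tsubst \<rho> (\<sigma> i))) [0..<n]) (fsubst \<rho> \<phi>)"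
  define \<chi> where "\<chi> = foldr Ex [n..<n + B] body"
  have sat_body: "sat M s body \<longleftrightarrow> sat M (\<lambda>i. s (i + n)) \<phi> \<and>
      (\<forall>i < n. s i = tval M (\<lambda>i. s (i + n)) (\<sigma> i))" for M :: "('u, 'f, 'r) struct" and s
    by (auto simp: body_def sat_conj_list sat_fsubst tval_tsubst \<rho>_def)
  have "fvars body \<subseteq> {..<n} \<union> {n..<n + B}"
  proof -
    have "tvars (tsubst \<rho> (\<sigma> i)) \<subseteq> {n..<n + B}" if "i < n" for i
      using B that by (force simp: tvars_tsubst \<rho>_def)
    moreover have "fvars (fsubst \<rho> \<phi>) \<subseteq> {n..<n + B}"
      using fvars_fsubst[of \<rho> \<phi>] B by (force simp: \<rho>_def)
    ultimately show ?thesis by (fastforce simp: body_def fvars_conj_list)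
  qed
  moreover have "is_formula L body"
    using assms by (auto simp: body_def is_formula_conj_list \<rho>_def intro!: is_term_tsubst is_formula_fsubst)
  ultimately have \<chi>: "\<chi> \<in> formulas L {..<n}"
    by (auto simp: formulas_def \<chi>_def fvars_ex_list is_formula_ex_list)
  moreover have "sat M s \<chi> \<longleftrightarrow>
      (\<exists>s' \<in> assignments M. sat M s' \<phi> \<and> (\<forall>i < n. s i = tval M s' (\<sigma> i)))"
    if s: "s \<in> assignments M" for M :: "('u, 'f, 'r) struct" and s
  proof
    assume "sat M s \<chi>"
    then obtain s' where s': "\<forall>i \<in> {n..<n + B}. s' i \<in> Dom M"
      "\<forall>i. i \<notin> {n..<n + B} \<longrightarrow> s' i = s i" "sat M s' body"
      by (auto simp: \<chi>_def sat_ex_list)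
    have "s' i \<in> Dom M" for i
      using s' assignmentsD[OF s] by (cases "i \<in> {n..<n + B}") auto
    then have "(\<lambda>i. s' (i + n)) \<in> assignments M" by (auto simp: assignments_def)
    moreover have "\<forall>i < n. s i = tval M (\<lambda>i. s' (i + n)) (\<sigma> i)"
      using s'(2,3) by (auto simp: sat_body)
    ultimately show "\<exists>s' \<in> assignments M. sat M s' \<phi> \<and> (\<forall>i < n. s i = tval M s' (\<sigma> i))"
      using s'(3) sat_body by blast
  next
    assume "\<exists>s' \<in> assignments M. sat M s' \<phi> \<and> (\<forall>i < n. s i = tval M s' (\<sigma> i))"
    then obtain s' where s': "s' \<in> assignments M" "sat M s' \<phi>" "\<And>i. i < n \<Longrightarrow> s i = tval M s' (\<sigma> i)"
      by blast
    define s'' where "s'' i = (if i \<in> {n..<n + B} then s' (i - n) else s i)" for i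
    have "sat M (\<lambda>i. s'' (i + n)) \<phi> \<longleftrightarrow> sat M s' \<phi>"
      by (rule sat_cong) (use B in \<open>auto simp: s''_def\<close>)
    moreover have "tval M (\<lambda>i. s'' (i + n)) (\<sigma> i) = tval M s' (\<sigma> i)" if "i < n" for i
      by (rule tval_cong) (use B that in \<open>auto simp: s''_def\<close>)
    ultimately have "sat M s'' body"
      using s' by (auto simp: sat_body s''_def)
    moreover have "\<forall>i \<in> {n..<n + B}. s'' i \<in> Dom M"
      using s'(1) by (auto simp: s''_def assignmentsD)
    ultimately show "sat M s \<chi>"
      unfolding \<chi>_def sat_ex_list by (intro exI[of _ s'']) (auto simp: s''_def)
  qed
  ultimately show thesis using that by blast
qed

definition satisfiable_in :: "('u, 'f, 'r) struct \<Rightarrow> ('f, 'r) fm \<Rightarrow> bool" where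
  "satisfiable_in M \<phi> \<longleftrightarrow> (\<exists>s \<in> assignments M. sat M s \<phi>)"

definition ex_closure :: "('f, 'r) fm \<Rightarrow> ('f, 'r) fm" where
  "ex_closure \<phi> = foldr Ex (sorted_list_of_set (fvars \<phi>)) \<phi>"

lemma is_sentence_ex_closure: "is_formula L \<phi> \<Longrightarrow> is_sentence L (ex_closure \<phi>)"
  by (simp add: is_sentence_def ex_closure_def fvars_ex_list is_formula_ex_list finite_fvars)

lemma sat_ex_closure:
  assumes "is_struct L M"
  shows "sat M s (ex_closure \<phi>) \<longleftrightarrow> satisfiable_in M \<phi>"
proof
  assume "sat M s (ex_closure \<phi>)"
  then obtain s' where s': "\<forall>i \<in> fvars \<phi>. s' i \<in> Dom M" "sat M s' \<phi>"
    by (auto simp: ex_closure_def sat_ex_list finite_fvars)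
  obtain x where "x \<in> Dom M" using assms by (auto simp: is_struct_def)
  then have "(\<lambda>i. if i \<in> fvars \<phi> then s' i else x) \<in> assignments M"
    using s' by (auto simp: assignments_def)
  moreover have "sat M (\<lambda>i. if i \<in> fvars \<phi> then s' i else x) \<phi>"
    using s'(2) by (subst sat_cong[of _ _ s']) auto
  ultimately show "satisfiable_in M \<phi>" by (auto simp: satisfiable_in_def)
next
  assume "satisfiable_in M \<phi>"
  then obtain s' where s': "s' \<in> assignments M" "sat M s' \<phi>" by (auto simp: satisfiable_in_def)
  have "sat M (\<lambda>i. if i \<in> fvars \<phi> then s' i else s i) \<phi>"
    using s'(2) by (subst sat_cong[of _ _ s']) auto
  then show "sat M s (ex_closure \<phi>)"
    using assignmentsD[OF s'(1)] unfolding ex_closure_def sat_ex_list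
    by (intro exI[of _ "\<lambda>i. if i \<in> fvars \<phi> then s' i else s i"]) (simp add: finite_fvars)
qed

text \<open>
  Satisfiability of a formula is expressed by a sentence, its existential closure; the theory of \<open>M\<close>
  contains this sentence or its negation.
\<close>

lemma satisfiable_in_transfer:
  assumes M: "is_struct L M" and N: "is_model L (Th L M) N" and \<phi>: "is_formula L \<phi>"
  shows "satisfiable_in N \<phi> \<longleftrightarrow> satisfiable_in M \<phi>"
proof -
  have N': "is_struct L N" "\<And>\<psi>. \<psi> \<in> Th L M \<Longrightarrow> models_sentence N \<psi>"
    using N by (auto simp: is_model_def)
  then obtain x where x: "x \<in> Dom N" by (auto simp: is_struct_def)
  show ?thesis
  proof (cases "satisfiable_in M \<phi>")
    case True
    then have "ex_closure \<phi> \<in> Th L M"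
      using is_sentence_ex_closure[OF \<phi>] by (simp add: Th_def models_sentence_def sat_ex_closure[OF M])
    then have "sat N (\<lambda>_. x) (ex_closure \<phi>)"
      using N'(2)[of "ex_closure \<phi>"] x by (auto simp: models_sentence_def)
    then show ?thesis using True sat_ex_closure[OF N'(1)] by blast
  next
    case False
    then have "Neg (ex_closure \<phi>) \<in> Th L M"
      using is_sentence_ex_closure[OF \<phi>]
      by (simp add: Th_def models_sentence_def sat_ex_closure[OF M] is_sentence_def)
    then have "sat N (\<lambda>_. x) (Neg (ex_closure \<phi>))"
      using N'(2)[of "Neg (ex_closure \<phi>)"] x by (auto simp: models_sentence_def simp del: sat.simps)
    then show ?thesis using False sat_ex_closure[OF N'(1)] by simp
  qed
qed

section \<open>Countability of the syntax\<close>

text \<open>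
  Only the symbols in the language are countable, not the types of symbols. Injecting these symbols
  into the natural numbers reduces to the countable datatypes over natural numbers.
\<close>

instance tm :: (countable) countable by countable_datatype
instance fm :: (countable, countable) countable by countable_datatype

lemma symbols_of_term: "is_term L t \<Longrightarrow> set_tm t \<subseteq> Funs L"
  by (induction t) auto

lemma symbols_of_formula:
  "is_formula L \<phi> \<Longrightarrow> set1_fm \<phi> \<subseteq> Funs L \<and> set2_fm \<phi> \<subseteq> Rels L"
proof (induction \<phi>)
  case (Eq t u)
  then show ?case using symbols_of_term[of L t] symbols_of_term[of L u] by auto
next
  case (Rel r ts)
  then show ?case using symbols_of_term[of L] by fastforce
qed auto

lemma countable_terms:
  assumes "countable_lang L"
  shows "countable (terms L V)"
proof (rule countableI')
  define f where "f = to_nat_on (Funs L)"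
  have f: "inj_on f (Funs L)"
    using assms by (auto simp: f_def countable_lang_def inj_on_to_nat_on)
  show "inj_on (to_nat \<circ> map_tm f) (terms L V)"
  proof (rule inj_onI)
    fix t u assume tu: "t \<in> terms L V" "u \<in> terms L V" "(to_nat \<circ> map_tm f) t = (to_nat \<circ> map_tm f) u"
    then have "map_tm f t = map_tm f u" by simp
    moreover have "set_tm t \<subseteq> Funs L" "set_tm u \<subseteq> Funs L"
      using tu symbols_of_term by (auto simp: terms_def)
    ultimately show "t = u"
      using f by (intro tm.inj_map_strong[of t u f f]) (auto simp: inj_on_def)
  qed
qed

lemma countable_formulas:
  assumes "countable_lang L"
  shows "countable (formulas L V)"
proof (rule countableI')
  define f where "f = to_nat_on (Funs L)"
  define g where "g = to_nat_on (Rels L)"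
  have f: "inj_on f (Funs L)" "inj_on g (Rels L)"
    using assms by (auto simp: f_def g_def countable_lang_def inj_on_to_nat_on)
  show "inj_on (to_nat \<circ> map_fm f g) (formulas L V)"
  proof (rule inj_onI)
    fix t u assume tu: "t \<in> formulas L V" "u \<in> formulas L V"
      "(to_nat \<circ> map_fm f g) t = (to_nat \<circ> map_fm f g) u"
    then have "map_fm f g t = map_fm f g u" by simp
    moreover have "set1_fm t \<subseteq> Funs L" "set1_fm u \<subseteq> Funs L" "set2_fm t \<subseteq> Rels L" "set2_fm u \<subseteq> Rels L"
      using tu symbols_of_formula by (auto simp: formulas_def)
    ultimately show "t = u"
      using f by (intro fm.inj_map_strong[of t u f f g g]) (auto simp: inj_on_def, (meson subsetD)+)
  qed
qed

section \<open>Generic filters of assignments\<close>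

definition entails :: "('u, 'f, 'r) struct \<Rightarrow> ('f, 'r) fm \<Rightarrow> ('f, 'r) fm \<Rightarrow> bool" where
  "entails M \<phi> \<psi> \<longleftrightarrow> (\<forall>s \<in> assignments M. sat M s \<phi> \<longrightarrow> sat M s \<psi>)"

text \<open>
  Conditions are the satisfiable formulas that entail \<open>\<theta>\<close>. Compatibility of \<open>\<phi>\<close> with some member of
  \<open>E\<close> means that the condition can be strengthened to entail that member.
\<close>

definition dense_below ::
  "('f, 'r) lang \<Rightarrow> ('u, 'f, 'r) struct \<Rightarrow> nat set \<Rightarrow> ('f, 'r) fm \<Rightarrow> ('f, 'r) fm set \<Rightarrow> bool" where
  "dense_below L M V \<theta> E \<longleftrightarrow>
    (\<forall>\<phi> \<in> formulas L V. satisfiable_in M \<phi> \<and> entails M \<phi> \<theta> \<longrightarrow>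
      (\<exists>\<psi> \<in> E \<inter> formulas L V. satisfiable_in M (Conj \<phi> \<psi>)))"

text \<open>
  The argument of the Baire category theorem: a descending sequence of conditions enters one dense
  set after the other, and the sets that it defines form a filter base.
\<close>

lemma generic_filter:
  fixes L :: "('f, 'r) lang" and M :: "('u, 'f, 'r) struct"
  assumes R: "countable R" "\<And>E. E \<in> R \<Longrightarrow> dense_below L M V \<theta> E"
    and \<theta>: "\<theta> \<in> formulas L V" "satisfiable_in M \<theta>"
  obtains F where "F \<noteq> bot" "\<forall>\<^sub>F s in F. s \<in> assignments M"
    "\<forall>E \<in> R. \<exists>\<psi> \<in> E \<inter> formulas L V. \<forall>\<^sub>F s in F. sat M s \<psi>"
proof -
  define P where "P \<phi> \<longleftrightarrow> \<phi> \<in> formulas L V \<and> satisfiable_in M \<phi> \<and> entails M \<phi> \<theta>" for \<phi>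
  define Q where "Q k \<phi> \<phi>' \<longleftrightarrow> entails M \<phi>' \<phi> \<and>
    (from_nat_into R k \<in> R \<longrightarrow> (\<exists>\<psi> \<in> from_nat_into R k \<inter> formulas L V. entails M \<phi>' \<psi>))" for k \<phi> \<phi>'
  \<comment> \<open>The guard \<open>from_nat_into R k \<in> R\<close> fails only when \<open>R\<close> is empty.\<close>
  have "\<exists>\<phi>. \<forall>k. P (\<phi> k) \<and> Q k (\<phi> k) (\<phi> (Suc k))"
  proof (rule dependent_nat_choice)
    show "\<exists>\<phi>. P \<phi>" using \<theta> by (auto simp: P_def entails_def)
  next
    fix \<phi> k assume \<phi>: "P \<phi>"
    show "\<exists>\<phi>'. P \<phi>' \<and> Q k \<phi> \<phi>'"
    proof (cases "from_nat_into R k \<in> R")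
      case True
      then obtain \<psi> where "\<psi> \<in> from_nat_into R k \<inter> formulas L V" "satisfiable_in M (Conj \<phi> \<psi>)"
        using R(2)[OF True] \<phi> by (auto simp: P_def dense_below_def)
      then show ?thesis using \<phi>
        by (intro exI[of _ "Conj \<phi> \<psi>"]) (auto simp: P_def Q_def formulas_def entails_def)
    next
      case False
      then show ?thesis using \<phi> by (intro exI[of _ \<phi>]) (auto simp: P_def Q_def entails_def)
    qed
  qed
  then obtain \<phi> where P: "\<And>k. P (\<phi> k)" and Q: "\<And>k. Q k (\<phi> k) (\<phi> (Suc k))" by blast
  define X where "X k = {s \<in> assignments M. sat M s (\<phi> k)}" for k
  have "decseq X"
    unfolding decseq_Suc_iff using Q by (auto simp: X_def Q_def entails_def)
  define F where "F = (INF k. principal (X k))"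
  have F: "eventually S F \<longleftrightarrow> (\<exists>k. \<forall>s \<in> X k. S s)" for S
    unfolding F_def
  proof (subst eventually_INF_base)
    show "\<exists>k \<in> UNIV. principal (X k) \<le> inf (principal (X i)) (principal (X j))" for i j
      using decseqD[OF \<open>decseq X\<close>, of i "max i j"] decseqD[OF \<open>decseq X\<close>, of j "max i j"]
      by (intro bexI[of _ "max i j"]) auto
  qed (auto simp: eventually_principal)
  show thesis
  proof (rule that)
    have "X k \<noteq> {}" for k using P[of k] by (auto simp: P_def X_def satisfiable_in_def)
    then show "F \<noteq> bot" by (auto simp: trivial_limit_def F)
    show "\<forall>\<^sub>F s in F. s \<in> assignments M" by (auto simp: F X_def)
    show "\<forall>E \<in> R. \<exists>\<psi> \<in> E \<inter> formulas L V. \<forall>\<^sub>F s in F. sat M s \<psi>"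
    proof
      fix E assume "E \<in> R"
      then obtain k where "E = from_nat_into R k" using R(1) by (metis from_nat_into_surj)
      then obtain \<psi> where "\<psi> \<in> E \<inter> formulas L V" "entails M (\<phi> (Suc k)) \<psi>"
        using Q[of k] \<open>E \<in> R\<close> by (auto simp: Q_def)
      then show "\<exists>\<psi> \<in> E \<inter> formulas L V. \<forall>\<^sub>F s in F. sat M s \<psi>"
        by (intro bexI[of _ \<psi>]) (auto simp: F X_def entails_def)
    qed
  qed
qed

definition instance_of :: "('f, 'r) fm \<Rightarrow> nat \<Rightarrow> 'f tm \<Rightarrow> ('f, 'r) fm" where
  "instance_of \<psi> j \<tau> = fsubst (Var(j := \<tau>)) \<psi>"

lemma sat_instance_of: "sat M s (instance_of \<psi> j \<tau>) \<longleftrightarrow> sat M (s(j := tval M s \<tau>)) \<psi>"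
proof -
  have "(\<lambda>i. tval M s ((Var(j := \<tau>)) i)) = s(j := tval M s \<tau>)" by auto
  then show ?thesis by (simp only: instance_of_def sat_fsubst)
qed

lemma instance_of_in_formulas:
  "Ex j \<psi> \<in> formulas L V \<Longrightarrow> \<tau> \<in> terms L V \<Longrightarrow> instance_of \<psi> j \<tau> \<in> formulas L V"
  unfolding instance_of_def by (rule fsubst_in_formulas) (auto simp: formulas_def terms_def)

text \<open>
  The formulas that hold for almost all assignments form a complete type in the variables \<open>V\<close>
  with the Henkin property: a true existential formula is witnessed by a term in these variables.
\<close>

definition generic ::
  "('f, 'r) lang \<Rightarrow> ('u, 'f, 'r) struct \<Rightarrow> nat set \<Rightarrow> (nat \<Rightarrow> 'u) filter \<Rightarrow> bool" where
  "generic L M V F \<longleftrightarrow>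
    F \<noteq> bot \<and>
    (\<forall>\<^sub>F s in F. s \<in> assignments M) \<and>
    (\<forall>\<psi> \<in> formulas L V. (\<forall>\<^sub>F s in F. sat M s \<psi>) \<or> (\<forall>\<^sub>F s in F. \<not> sat M s \<psi>)) \<and>
    (\<forall>j \<psi>. Ex j \<psi> \<in> formulas L V \<and> (\<forall>\<^sub>F s in F. sat M s (Ex j \<psi>)) \<longrightarrow>
      (\<exists>\<tau> \<in> terms L V. \<forall>\<^sub>F s in F. sat M s (instance_of \<psi> j \<tau>)))"

text \<open>
  Deciding a formula and witnessing an existential formula are dense requirements, and there are
  countably many of them. Hence genericity can be obtained together with countably many further
  dense requirements. Witnesses are where the variables \<open>V\<close> matter, so their existence is left as a
  hypothesis.
\<close>

lemma generic_exists:
  fixes L :: "('f, 'r) lang" and M :: "('u, 'f, 'r) struct"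
  assumes L: "countable_lang L"
    and R: "countable R" "\<And>E. E \<in> R \<Longrightarrow> dense_below L M V \<theta> E"
    and \<theta>: "\<theta> \<in> formulas L V" "satisfiable_in M \<theta>"
    and wit: "\<And>\<phi> j \<psi>. \<phi> \<in> formulas L V \<Longrightarrow> entails M \<phi> \<theta> \<Longrightarrow> Ex j \<psi> \<in> formulas L V \<Longrightarrow>
      satisfiable_in M (Conj \<phi> (Ex j \<psi>)) \<Longrightarrow>
      \<exists>\<tau> \<in> terms L V. satisfiable_in M (Conj \<phi> (instance_of \<psi> j \<tau>))"
  shows "\<exists>F. generic L M V F \<and> (\<forall>E \<in> R. \<exists>\<psi> \<in> E \<inter> formulas L V. \<forall>\<^sub>F s in F. sat M s \<psi>)"
proof -
  define decide where "decide \<psi> = {\<psi>, Neg \<psi>}" for \<psi> :: "('f, 'r) fm"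
  define witness :: "nat \<times> ('f, 'r) fm \<Rightarrow> ('f, 'r) fm set"
    where "witness = (\<lambda>(j, \<psi>). insert (Neg (Ex j \<psi>)) (instance_of \<psi> j ` terms L V))"
  define W where "W = {(j, \<psi>). Ex j \<psi> \<in> formulas L V}"
  have "W \<subseteq> UNIV \<times> formulas L UNIV" by (auto simp: W_def formulas_def)
  then have "countable W"
    using countable_formulas[OF L] by (meson countable_SIGMA countable_subset countableI_type)
  then have "countable (R \<union> decide ` formulas L V \<union> witness ` W)"
    using R(1) countable_formulas[OF L] by auto
  moreover have "dense_below L M V \<theta> E" if "E \<in> R \<union> decide ` formulas L V \<union> witness ` W" for E
    using that
  proof (elim UnE imageE)
    fix \<psi> assume "E = decide \<psi>" "\<psi> \<in> formulas L V"
    then show ?thesis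
      by (auto simp: dense_below_def decide_def satisfiable_in_def formulas_def)
  next
    fix w assume w: "E = witness w" "w \<in> W"
    then obtain j \<psi> where [simp]: "w = (j, \<psi>)" and j: "Ex j \<psi> \<in> formulas L V"
      by (auto simp: W_def)
    show ?thesis
      unfolding dense_below_def
    proof (intro ballI impI)
      fix \<phi> assume \<phi>: "\<phi> \<in> formulas L V" "satisfiable_in M \<phi> \<and> entails M \<phi> \<theta>"
      show "\<exists>\<chi> \<in> E \<inter> formulas L V. satisfiable_in M (Conj \<phi> \<chi>)"
      proof (cases "satisfiable_in M (Conj \<phi> (Ex j \<psi>))")
        case True
        then obtain \<tau> where "\<tau> \<in> terms L V" "satisfiable_in M (Conj \<phi> (instance_of \<psi> j \<tau>))"
          using wit \<phi> j by blast
        then show ?thesis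
          using w(1) instance_of_in_formulas[OF j] by (auto simp: witness_def)
      next
        case False
        then have "satisfiable_in M (Conj \<phi> (Neg (Ex j \<psi>)))"
          using \<phi> by (auto simp: satisfiable_in_def)
        moreover have "Neg (Ex j \<psi>) \<in> E \<inter> formulas L V"
          using w(1) j by (auto simp: witness_def formulas_def)
        ultimately show ?thesis by blast
      qed
    qed
  qed (rule R(2))
  ultimately obtain F where F: "F \<noteq> bot" "\<forall>\<^sub>F s in F. s \<in> assignments M"
    and *: "\<forall>E \<in> R \<union> decide ` formulas L V \<union> witness ` W.
      \<exists>\<psi> \<in> E \<inter> formulas L V. \<forall>\<^sub>F s in F. sat M s \<psi>"
    using \<theta> by (rule generic_filter) blast
  have "(\<forall>\<^sub>F s in F. sat M s \<psi>) \<or> (\<forall>\<^sub>F s in F. \<not> sat M s \<psi>)" if "\<psi> \<in> formulas L V" for \<psi>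
    using *[rule_format, of "decide \<psi>"] that by (auto simp: decide_def)
  moreover have "\<exists>\<tau> \<in> terms L V. \<forall>\<^sub>F s in F. sat M s (instance_of \<psi> j \<tau>)"
    if "Ex j \<psi> \<in> formulas L V" "\<forall>\<^sub>F s in F. sat M s (Ex j \<psi>)" for j \<psi>
  proof -
    have "\<not> (\<forall>\<^sub>F s in F. sat M s (Neg (Ex j \<psi>)))"
    proof
      assume "\<forall>\<^sub>F s in F. sat M s (Neg (Ex j \<psi>))"
      with that(2) have "\<forall>\<^sub>F s in F. False" by eventually_elim simp
      then show False using F(1) by (simp add: trivial_limit_def)
    qed
    moreover have "(j, \<psi>) \<in> W" using that by (simp add: W_def)
    then have "\<exists>\<chi> \<in> witness (j, \<psi>) \<inter> formulas L V. \<forall>\<^sub>F s in F. sat M s \<chi>"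
      by (intro *[rule_format]) blast
    ultimately show ?thesis by (auto simp only: witness_def prod.case)
  qed
  ultimately have "generic L M V F" using F by (auto simp: generic_def simp del: sat.simps)
  then show ?thesis using * by blast
qed

section \<open>The term model of a generic filter\<close>

lemma lift_assignment:
  assumes "s \<in> assignments N" "Dom N = h ` A"
  obtains \<sigma> where "range \<sigma> \<subseteq> A" "s = h \<circ> \<sigma>"
proof
  have "s i \<in> h ` A" for i using assms by (auto simp: assignments_def)
  then show "range (inv_into A h \<circ> s) \<subseteq> A" "s = h \<circ> (inv_into A h \<circ> s)"
    by (auto simp: inv_into_into f_inv_into_f fun_eq_iff)
qed

text \<open>
  The terms in \<open>V\<close>, evaluated as functions of the assignment and identified when they agree almost
  everywhere, form a submodel of the reduced power of \<open>M\<close> by \<open>F\<close>. Genericity gives the theorem of Los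
  for it: completeness handles negation and the Henkin property handles existential quantifiers. There
  are countably many terms, so the classes inject into any infinite type; \<open>h\<close> sends a term to the
  point that represents its class. Substitutions \<open>\<sigma>\<close> play the role of assignments into the model.
\<close>

lemma term_model:
  fixes L :: "('f, 'r) lang" and M :: "('u, 'f, 'r) struct"
  assumes L: "countable_lang L" and M: "is_struct L M" and gen: "generic L M V F"
    and V: "V \<noteq> {}"
  obtains N :: "('v::infinite, 'f, 'r) struct" and h where
    "is_struct L N" "Dom N = h ` terms L V"
    "\<And>\<sigma> \<phi>. range \<sigma> \<subseteq> terms L V \<Longrightarrow> is_formula L \<phi> \<Longrightarrow>
      sat N (h \<circ> \<sigma>) \<phi> \<longleftrightarrow> (\<forall>\<^sub>F s in F. sat M (\<lambda>i. tval M s (\<sigma> i)) \<phi>)"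
    "\<And>\<sigma> t. range \<sigma> \<subseteq> terms L V \<Longrightarrow> is_term L t \<Longrightarrow> tval N (h \<circ> \<sigma>) t = h (tsubst \<sigma> t)"
    "\<And>\<phi>. is_formula L \<phi> \<Longrightarrow> models_sentence M \<phi> \<Longrightarrow> models_sentence N \<phi>"
proof -
  let ?Tm = "terms L V"
  define same where "same t u \<longleftrightarrow> (\<forall>\<^sub>F s in F. tval M s t = tval M s u)" for t u
  define cls where "cls t = {u \<in> ?Tm. same t u}" for t
  have cls: "cls t = cls u \<longleftrightarrow> same t u" if "t \<in> ?Tm" "u \<in> ?Tm" for t u
  proof
    assume "cls t = cls u"
    then have "u \<in> cls t" using that by (simp add: cls_def same_def)
    then show "same t u" by (simp add: cls_def)
  next
    assume tu: "same t u"
    have "same t v \<longleftrightarrow> same u v" for v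
      unfolding same_def using tu
      by (intro eventually_subst) (auto simp: same_def elim: eventually_mono)
    then show "cls t = cls u" by (simp add: cls_def)
  qed
  have "countable (cls ` ?Tm)" using countable_terms[OF L] by auto
  then obtain g :: "'f tm set \<Rightarrow> nat" where g: "inj_on g (cls ` ?Tm)" by (auto simp: countable_def)
  obtain e :: "nat \<Rightarrow> 'v" where e: "inj e"
    using infinite_countable_subset[OF infinite_UNIV] by blast
  define h where "h t = e (g (cls t))" for t
  have h: "h t = h u \<longleftrightarrow> same t u" if "t \<in> ?Tm" "u \<in> ?Tm" for t u
    using that cls[OF that] g e by (auto simp: h_def inj_on_def)
  \<comment> \<open>Points are read back as terms through \<open>r\<close>; \<open>r (h t)\<close> is only almost everywhere equal to \<open>t\<close>.\<close>
  define r where "r = inv_into ?Tm h"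
  define N where "N = \<lparr>Dom = h ` ?Tm, fint = \<lambda>f xs. h (App f (map r xs)),
    rint = \<lambda>R xs. \<forall>\<^sub>F s in F. rint M R (map (tval M s) (map r xs))\<rparr>"
  have r: "r x \<in> ?Tm" if "x \<in> h ` ?Tm" for x using that by (simp add: r_def inv_into_into)
  have same_r: "same (r (h t)) t" if "t \<in> ?Tm" for t
    using that h[of "r (h t)" t] r[of "h t"] by (simp add: r_def f_inv_into_f)
  have same_args: "\<forall>\<^sub>F s in F. map (tval M s) (map r (map h ts)) = map (tval M s) ts"
    if "set ts \<subseteq> ?Tm" for ts
  proof -
    have "\<forall>\<^sub>F s in F. \<forall>t \<in> set ts. tval M s (r (h t)) = tval M s t"
      using that same_r by (intro eventually_ball_finite) (auto simp: same_def)
    then show ?thesis by eventually_elim simp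
  qed
  have closed: "App f ts \<in> ?Tm" if "f \<in> Funs L" "length ts = farity L f" "set ts \<subseteq> ?Tm" for f ts
    using that by (auto simp: terms_def)
  have N: "is_struct L N"
  proof -
    have "Var i \<in> ?Tm" if "i \<in> V" for i using that by (simp add: terms_def)
    then have "?Tm \<noteq> {}" using V by blast
    moreover have "App f (map r a) \<in> ?Tm" if "f \<in> Funs L" "a \<in> tuples N (farity L f)" for f a
      by (rule closed) (use that r in \<open>auto simp: tuples_def N_def\<close>)
    ultimately show ?thesis by (auto simp: is_struct_def N_def)
  qed
  have tval_N: "tval N (h \<circ> \<sigma>) t = h (tsubst \<sigma> t)" if \<sigma>: "range \<sigma> \<subseteq> ?Tm" and "is_term L t" for \<sigma> t
    using that(2)
  proof (induction t)
    case (App f ts)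
    let ?us = "map (tsubst \<sigma>) ts"
    have us: "set ?us \<subseteq> ?Tm"
      using App.prems \<sigma> by (auto intro!: tsubst_in_terms)
    have "map (tval N (h \<circ> \<sigma>)) ts = map h ?us" using App by (simp add: comp_def)
    then have "tval N (h \<circ> \<sigma>) (App f ts) = h (App f (map r (map h ?us)))"
      by (simp only: tval.simps) (simp add: N_def)
    also have "\<dots> = h (App f ?us)"
    proof (subst h)
      show "App f ?us \<in> ?Tm" by (rule closed) (use us App.prems in auto)
      show "App f (map r (map h ?us)) \<in> ?Tm"
        by (rule closed) (use us App.prems r in auto)
      show "same (App f (map r (map h ?us))) (App f ?us)"
        unfolding same_def using same_args[OF us] by eventually_elim (simp only: tval.simps)
    qed
    finally show ?case by (simp only: tsubst.simps)
  qed simp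
  have truth: "sat N (h \<circ> \<sigma>) \<phi> \<longleftrightarrow> (\<forall>\<^sub>F s in F. sat M (\<lambda>i. tval M s (\<sigma> i)) \<phi>)"
    if "range \<sigma> \<subseteq> ?Tm" "is_formula L \<phi>" for \<sigma> \<phi>
    using that
  proof (induction \<phi> arbitrary: \<sigma>)
    case (Eq t u)
    then have "tsubst \<sigma> t \<in> ?Tm" "tsubst \<sigma> u \<in> ?Tm" by (auto intro!: tsubst_in_terms)
    moreover have "tval N (h \<circ> \<sigma>) t = h (tsubst \<sigma> t)" "tval N (h \<circ> \<sigma>) u = h (tsubst \<sigma> u)"
      using Eq by (auto intro!: tval_N)
    ultimately show ?case by (simp only: sat.simps h same_def tval_tsubst)
  next
    case (Rel R ts)
    let ?us = "map (tsubst \<sigma>) ts"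
    have us: "set ?us \<subseteq> ?Tm"
      using Rel.prems by (auto intro!: tsubst_in_terms)
    have "map (tval N (h \<circ> \<sigma>)) ts = map h ?us" using Rel by (simp add: tval_N)
    then have "sat N (h \<circ> \<sigma>) (Rel R ts) \<longleftrightarrow>
        (\<forall>\<^sub>F s in F. rint M R (map (tval M s) (map r (map h ?us))))"
      by (simp only: sat.simps) (simp only: N_def struct.select_convs)
    also have "\<dots> \<longleftrightarrow> (\<forall>\<^sub>F s in F. rint M R (map (tval M s) ?us))"
      by (rule eventually_subst) (use same_args[OF us] in \<open>eventually_elim, simp only:\<close>)
    also have "\<dots> \<longleftrightarrow> (\<forall>\<^sub>F s in F. sat M (\<lambda>i. tval M s (\<sigma> i)) (Rel R ts))"
      by (simp add: tval_tsubst comp_def)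
    finally show ?case .
  next
    case (Neg \<phi>)
    have "fsubst \<sigma> \<phi> \<in> formulas L V" using Neg.prems by (intro fsubst_in_formulas) auto
    then have "(\<forall>\<^sub>F s in F. sat M s (fsubst \<sigma> \<phi>)) \<or> (\<forall>\<^sub>F s in F. \<not> sat M s (fsubst \<sigma> \<phi>))"
      and "F \<noteq> bot" using gen by (auto simp: generic_def)
    then have "\<not> (\<forall>\<^sub>F s in F. sat M (\<lambda>i. tval M s (\<sigma> i)) \<phi>) \<longleftrightarrow>
        (\<forall>\<^sub>F s in F. \<not> sat M (\<lambda>i. tval M s (\<sigma> i)) \<phi>)"
      unfolding sat_fsubst using eventually_conj by (fastforce simp: trivial_limit_def)
    then show ?case using Neg by simp
  next
    case (Conj \<phi> \<psi>)
    then show ?case by (simp add: eventually_conj_iff)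
  next
    case (Ex i \<phi>)
    have upd: "sat N ((h \<circ> \<sigma>)(i := h \<tau>)) \<phi> \<longleftrightarrow>
        (\<forall>\<^sub>F s in F. sat M ((\<lambda>i. tval M s (\<sigma> i))(i := tval M s \<tau>)) \<phi>)" if "\<tau> \<in> ?Tm" for \<tau>
    proof -
      have "(h \<circ> \<sigma>)(i := h \<tau>) = h \<circ> (\<sigma>(i := \<tau>))" by auto
      moreover have "(\<lambda>k. tval M s ((\<sigma>(i := \<tau>)) k)) = (\<lambda>i. tval M s (\<sigma> i))(i := tval M s \<tau>)" for s
        by auto
      moreover have "range (\<sigma>(i := \<tau>)) \<subseteq> ?Tm" using Ex.prems(1) that by auto
      moreover have "is_formula L \<phi>" using Ex.prems(2) by simp
      ultimately show ?thesis using Ex.IH[of "\<sigma>(i := \<tau>)"] by (simp only:)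
    qed
    show ?case
    proof
      assume "sat N (h \<circ> \<sigma>) (Ex i \<phi>)"
      then obtain \<tau> where \<tau>: "\<tau> \<in> ?Tm" "sat N ((h \<circ> \<sigma>)(i := h \<tau>)) \<phi>" by (auto simp: N_def)
      have "\<forall>\<^sub>F s in F. s \<in> assignments M" using gen by (simp add: generic_def)
      then have "\<forall>\<^sub>F s in F. tval M s \<tau> \<in> Dom M"
        by eventually_elim (use \<tau>(1) in \<open>auto simp: terms_def intro: tval_in_Dom[OF M]\<close>)
      then show "\<forall>\<^sub>F s in F. sat M (\<lambda>i. tval M s (\<sigma> i)) (Ex i \<phi>)"
        using \<tau>(2)[unfolded upd[OF \<tau>(1)]] by eventually_elim auto
    next
      assume ev: "\<forall>\<^sub>F s in F. sat M (\<lambda>i. tval M s (\<sigma> i)) (Ex i \<phi>)"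
      define j where "j = fresh (\<Union>k \<in> fvars \<phi> - {i}. tvars (\<sigma> k))"
      define \<psi> where "\<psi> = fsubst (\<sigma>(i := Var j)) \<phi>"
      have Ex_\<psi>: "fsubst \<sigma> (Ex i \<phi>) = Ex j \<psi>" by (simp add: j_def \<psi>_def Let_def)
      have "Ex j \<psi> \<in> formulas L V"
        unfolding Ex_\<psi>[symmetric] using Ex.prems by (intro fsubst_in_formulas) auto
      moreover have "\<forall>\<^sub>F s in F. sat M s (Ex j \<psi>)"
        unfolding Ex_\<psi>[symmetric] sat_fsubst by (rule ev)
      ultimately obtain \<tau> where \<tau>: "\<tau> \<in> ?Tm" "\<forall>\<^sub>F s in F. sat M s (instance_of \<psi> j \<tau>)"
        using gen unfolding generic_def by blast
      have "sat M s (instance_of \<psi> j \<tau>) \<longleftrightarrow> sat M ((\<lambda>i. tval M s (\<sigma> i))(i := tval M s \<tau>)) \<phi>" for s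
        unfolding sat_instance_of \<psi>_def sat_fsubst
        by (rule sat_fsubst_binder) (use fresh_subst in \<open>simp add: j_def\<close>)
      then have "sat N ((h \<circ> \<sigma>)(i := h \<tau>)) \<phi>" using \<tau> by (simp add: upd)
      then show "sat N (h \<circ> \<sigma>) (Ex i \<phi>)" using \<tau>(1) by (auto simp: N_def)
    qed
  qed
  have "models_sentence N \<phi>" if \<phi>: "is_formula L \<phi>" "models_sentence M \<phi>" for \<phi>
    unfolding models_sentence_def
  proof (intro allI impI)
    fix s :: "nat \<Rightarrow> 'v" assume "range s \<subseteq> Dom N"
    then have "s \<in> assignments N" "Dom N = h ` ?Tm" by (simp_all add: assignments_def N_def)
    then obtain \<sigma> where \<sigma>: "range \<sigma> \<subseteq> ?Tm" "s = h \<circ> \<sigma>" by (rule lift_assignment)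
    have "\<forall>\<^sub>F s in F. s \<in> assignments M" using gen by (simp add: generic_def)
    then have "\<forall>\<^sub>F s in F. sat M (\<lambda>i. tval M s (\<sigma> i)) \<phi>"
    proof eventually_elim
      fix s assume s: "s \<in> assignments M"
      have "tval M s (\<sigma> i) \<in> Dom M" for i
        using \<sigma>(1) by (intro tval_in_Dom[OF M _ s]) (auto simp: terms_def)
      then have "range (\<lambda>i. tval M s (\<sigma> i)) \<subseteq> Dom M" by auto
      then show "sat M (\<lambda>i. tval M s (\<sigma> i)) \<phi>" using \<phi>(2) unfolding models_sentence_def by blast
    qed
    then show "sat N s \<phi>" using truth \<sigma> \<phi>(1) by simp
  qed
  then show thesis using that[of N h] N tval_N truth by (simp add: N_def)
qed

section \<open>Generation by the values of finitely many variables\<close>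

text \<open>
  Generation by the tuple \<open>(s 0, \<dots>, s (n - 1))\<close>. Beyond the length of \<open>a\<close> the values of \<open>asg a\<close> may
  lie outside the structure, so an assignment \<open>s\<close> that extends \<open>a\<close> within the structure takes its place.
\<close>

definition spans :: "('f, 'r) lang \<Rightarrow> ('u, 'f, 'r) struct \<Rightarrow> nat \<Rightarrow> (nat \<Rightarrow> 'u) \<Rightarrow> bool" where
  "spans L M n s \<longleftrightarrow> (\<forall>x \<in> Dom M. \<exists>\<tau> \<in> terms L {..<n}. x = tval M s \<tau>)"

lemma generates_iff_spans:
  assumes "a \<in> tuples M n" "\<And>i. i < n \<Longrightarrow> s i = a ! i"
  shows "generates L M a \<longleftrightarrow> spans L M n s"
proof -
  have "tval M (asg a) \<tau> = tval M s \<tau>" if "\<tau> \<in> terms L {..<n}" for \<tau>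
    by (rule tval_cong) (use assms that in \<open>auto simp: asg_def tuples_def terms_def\<close>)
  then have "(\<exists>\<tau> \<in> terms L {..<n}. x = tval M (asg a) \<tau>) \<longleftrightarrow> (\<exists>\<tau> \<in> terms L {..<n}. x = tval M s \<tau>)"
    for x by simp
  moreover have "generates L M a \<longleftrightarrow> (\<forall>x \<in> Dom M. \<exists>\<tau> \<in> terms L {..<n}. x = tval M (asg a) \<tau>)"
    using assms(1) by (auto simp: generates_def tuples_def terms_def)
  ultimately show ?thesis by (simp add: spans_def)
qed

lemma sat_asg_iff:
  assumes "a \<in> tuples M n" "\<And>i. i < n \<Longrightarrow> s i = a ! i" "fvars \<phi> \<subseteq> {..<n}"
  shows "sat N (asg a) \<phi> \<longleftrightarrow> sat N s \<phi>"
  by (rule sat_cong) (use assms in \<open>auto simp: asg_def tuples_def\<close>)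

lemma tuple_of_assignment:
  assumes "s \<in> assignments M"
  shows "map s [0..<n] \<in> tuples M n" "\<And>i. i < n \<Longrightarrow> s i = map s [0..<n] ! i"
  using assms by (auto simp: tuples_def assignments_def)

lemma assignment_of_tuple:
  assumes "is_struct L M" "a \<in> tuples M n"
  obtains s where "s \<in> assignments M" "\<And>i. i < n \<Longrightarrow> s i = a ! i"
proof -
  obtain x where "x \<in> Dom M" using assms(1) by (auto simp: is_struct_def)
  moreover have "a ! i \<in> Dom M" if "i < n" for i
    using assms(2) that nth_mem[of i a] by (auto simp: tuples_def)
  ultimately have "(\<lambda>i. if i < n then a ! i else x) \<in> assignments M"
    by (auto simp: assignments_def)
  then show thesis using that by fastforce
qed

lemma spans_trans:
  assumes "spans L M m s'" "\<And>i. i < m \<Longrightarrow> s' i = tval M s (\<sigma> i)"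
    "\<And>i. i < m \<Longrightarrow> \<sigma> i \<in> terms L {..<n}"
  shows "spans L M n s"
  unfolding spans_def
proof
  fix x assume "x \<in> Dom M"
  then obtain \<tau> where \<tau>: "\<tau> \<in> terms L {..<m}" "x = tval M s' \<tau>"
    using assms(1) by (auto simp: spans_def)
  have "tval M s' \<tau> = tval M (\<lambda>i. tval M s (\<sigma> i)) \<tau>"
    by (rule tval_cong) (use \<tau> assms(2) in \<open>auto simp: terms_def\<close>)
  then have "x = tval M s (tsubst \<sigma> \<tau>)" using \<tau> by (simp add: tval_tsubst)
  moreover have "tsubst \<sigma> \<tau> \<in> terms L {..<n}"
    using \<tau> assms(3) by (intro tsubst_in_terms) (auto simp: terms_def)
  ultimately show "\<exists>\<tau> \<in> terms L {..<n}. x = tval M s \<tau>" by blast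
qed

lemma spans_assignment:
  assumes "spans L M n s" "s' \<in> assignments M"
  obtains \<sigma> where "range \<sigma> \<subseteq> terms L {..<n}" "\<And>i. s' i = tval M s (\<sigma> i)"
proof -
  have "\<forall>i. \<exists>\<tau>. \<tau> \<in> terms L {..<n} \<and> s' i = tval M s \<tau>"
    using assms assignmentsD[OF assms(2)] by (auto simp: spans_def)
  then obtain \<sigma> where "\<And>i. \<sigma> i \<in> terms L {..<n} \<and> s' i = tval M s (\<sigma> i)" by metis
  then show thesis using that by blast
qed

section \<open>Complete formulas\<close>

text \<open>
  These are the formulas that isolate a complete \<open>n\<close>-type realised in \<open>M\<close>.
\<close>

definition complete_formula ::
  "('f, 'r) lang \<Rightarrow> ('u, 'f, 'r) struct \<Rightarrow> nat \<Rightarrow> ('f, 'r) fm \<Rightarrow> bool" where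
  "complete_formula L M n \<phi> \<longleftrightarrow>
    \<phi> \<in> formulas L {..<n} \<and> satisfiable_in M \<phi> \<and>
    (\<forall>\<psi> \<in> formulas L {..<n}. entails M \<phi> \<psi> \<or> entails M \<phi> (Neg \<psi>))"

lemma complete_formula_same_type:
  assumes "complete_formula L M n \<phi>" "\<psi> \<in> formulas L {..<n}"
    "s \<in> assignments M" "sat M s \<phi>" "s' \<in> assignments M" "sat M s' \<phi>"
  shows "sat M s \<psi> \<longleftrightarrow> sat M s' \<psi>"
  using assms by (auto simp: complete_formula_def entails_def)

text \<open>
  Some \<open>c\<close> in \<open>N\<close> satisfies \<open>\<phi>\<close>. Since \<open>\<phi>\<close> isolates the type of \<open>s\<close>, the tuple \<open>c\<close> realises the same
  type, so \<open>\<tau>(s) \<mapsto> \<tau>(c)\<close> is well defined and elementary on the elements of \<open>M\<close>, all of which are of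
  the form \<open>\<tau>(s)\<close>.
\<close>

lemma prime_if_complete_formula:
  fixes M :: "('u, 'f, 'r) struct"
  assumes M: "is_struct L M" and \<phi>: "complete_formula L M n \<phi>"
    and s: "s \<in> assignments M" "sat M s \<phi>" "spans L M n s"
  shows "prime_model TYPE('v::infinite) L M"
  unfolding prime_model_def
proof (intro conjI M allI impI)
  fix N :: "('v, 'f, 'r) struct" assume N: "is_model L (Th L M) N"
  have \<phi>': "is_formula L \<phi>" using \<phi> by (simp add: complete_formula_def formulas_def)
  have "satisfiable_in N \<phi>"
    using s by (subst satisfiable_in_transfer[OF M N \<phi>']) (auto simp: satisfiable_in_def)
  then obtain c where c: "c \<in> assignments N" "sat N c \<phi>" by (auto simp: satisfiable_in_def)
  have imp: "sat N c \<psi>" if \<psi>: "\<psi> \<in> formulas L {..<n}" "sat M s \<psi>" for \<psi>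
  proof (rule ccontr)
    assume "\<not> sat N c \<psi>"
    then have "satisfiable_in N (Conj \<phi> (Neg \<psi>))" using c by (auto simp: satisfiable_in_def)
    moreover have "is_formula L (Conj \<phi> (Neg \<psi>))" using \<phi>' \<psi> by (simp add: formulas_def)
    ultimately have "satisfiable_in M (Conj \<phi> (Neg \<psi>))"
      using satisfiable_in_transfer[OF M N] by blast
    then show False
      using complete_formula_same_type[OF \<phi> \<psi>(1) s(1,2)] \<psi>(2) by (auto simp: satisfiable_in_def)
  qed
  have same: "sat N c \<psi> \<longleftrightarrow> sat M s \<psi>" if "\<psi> \<in> formulas L {..<n}" for \<psi>
    using imp[of \<psi>] imp[of "Neg \<psi>"] that by (auto simp: formulas_def)
  define t where "t x = (SOME \<tau>. \<tau> \<in> terms L {..<n} \<and> x = tval M s \<tau>)" for x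
  have t: "t x \<in> terms L {..<n}" "x = tval M s (t x)" if "x \<in> Dom M" for x
    using someI_ex[of "\<lambda>\<tau>. \<tau> \<in> terms L {..<n} \<and> x = tval M s \<tau>"] s(3) that
    by (auto simp: t_def spans_def)
  define h where "h x = tval N c (t x)" for x
  have "h x \<in> Dom N" if "x \<in> Dom M" for x
    unfolding h_def using N t(1)[OF that] c(1) by (intro tval_in_Dom[of L]) (auto simp: is_model_def terms_def)
  moreover have "sat M u \<chi> \<longleftrightarrow> sat N (h \<circ> u) \<chi>" if "is_formula L \<chi>" "range u \<subseteq> Dom M" for \<chi> u
  proof -
    have u: "u i \<in> Dom M" for i using that(2) by auto
    have "sat M u \<chi> \<longleftrightarrow> sat M s (fsubst (t \<circ> u) \<chi>)"
      unfolding sat_fsubst using t(2)[OF u] by (intro sat_cong) simp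
    also have "\<dots> \<longleftrightarrow> sat N c (fsubst (t \<circ> u) \<chi>)"
      using that(1) t(1)[OF u] by (intro same[symmetric] fsubst_in_formulas) auto
    also have "\<dots> \<longleftrightarrow> sat N (h \<circ> u) \<chi>"
      unfolding sat_fsubst by (intro sat_cong) (simp add: h_def)
    finally show ?thesis .
  qed
  ultimately show "\<exists>h. elementary_embedding L M N h"
    by (auto simp: elementary_embedding_def intro!: exI[of _ h])
qed

section \<open>Prime models realise isolated types\<close>

text \<open>
  The elements of a term model are the terms in all variables. To omit \<open>p\<close> it suffices that for each
  \<open>n\<close>-tuple \<open>ts\<close> of terms some \<open>\<not> \<psi>(ts)\<close> with \<open>\<psi> \<in> p\<close> is true. This requirement is dense: if a
  condition \<open>\<phi>\<close> entailed \<open>\<psi>(ts)\<close> for all \<open>\<psi> \<in> p\<close>, then the formula defining the image of \<open>\<phi>\<close> under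
  \<open>ts\<close> would isolate \<open>p\<close>.
\<close>

lemma omitting_non_isolated_type:
  fixes L :: "('f, 'r) lang" and M :: "('u, 'f, 'r) struct"
  assumes L: "countable_lang L" and M: "is_struct L M" and p: "p \<subseteq> formulas L {..<n}"
    and noniso: "\<And>\<phi>. \<phi> \<in> formulas L {..<n} \<Longrightarrow> satisfiable_in M \<phi> \<Longrightarrow> \<exists>\<psi> \<in> p. \<not> entails M \<phi> \<psi>"
  obtains N :: "('v::infinite, 'f, 'r) struct" where "is_model L (Th L M) N"
    "\<And>s. s \<in> assignments N \<Longrightarrow> \<exists>\<psi> \<in> p. \<not> sat N s \<psi>"
proof -
  define E where "E ts = (\<lambda>\<psi>. Neg (fsubst (\<lambda>i. ts ! i) \<psi>)) ` p" for ts :: "'f tm list"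
  define TS where "TS = {ts \<in> lists (terms L UNIV). length ts = n}"
  \<comment> \<open>The conditions below a valid formula are all satisfiable formulas.\<close>
  define \<theta> :: "('f, 'r) fm" where "\<theta> = Eq (Var 0) (Var 0)"
  have "countable TS"
    unfolding TS_def using countable_terms[OF L] by (auto intro: countable_subset[OF _ countable_lists])
  have E: "dense_below L M UNIV \<theta> (E ts)" if "ts \<in> TS" for ts
    unfolding dense_below_def
  proof (intro ballI impI)
    fix \<phi> assume \<phi>: "\<phi> \<in> formulas L UNIV" "satisfiable_in M \<phi> \<and> entails M \<phi> \<theta>"
    have ts: "ts ! i \<in> terms L UNIV" if "i < n" for i
      using \<open>ts \<in> TS\<close> that nth_mem[of i ts] by (auto simp: TS_def)
    obtain \<chi> where \<chi>: "\<chi> \<in> formulas L {..<n}"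
      "\<And>(M :: ('u, 'f, 'r) struct) s. s \<in> assignments M \<Longrightarrow> sat M s \<chi> \<longleftrightarrow>
        (\<exists>s' \<in> assignments M. sat M s' \<phi> \<and> (\<forall>i < n. s i = tval M s' (ts ! i)))"
      using image_definable[of L \<phi> n "\<lambda>i. ts ! i"] \<phi>(1) ts by (auto simp: formulas_def terms_def)
    obtain s where s: "s \<in> assignments M" "sat M s \<phi>" using \<phi>(2) by (auto simp: satisfiable_in_def)
    define s' where "s' i = (if i < n then tval M s (ts ! i) else s i)" for i
    have "s' \<in> assignments M"
      using s(1) ts tval_in_Dom[OF M _ s(1)] by (auto simp: assignments_def s'_def terms_def)
    moreover have "sat M s' \<chi>" using \<chi>(2)[OF \<open>s' \<in> assignments M\<close>] s by (auto simp: s'_def)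
    ultimately obtain \<psi> where \<psi>: "\<psi> \<in> p" "\<not> entails M \<chi> \<psi>"
      using noniso[OF \<chi>(1)] by (auto simp: satisfiable_in_def)
    then obtain u where u: "u \<in> assignments M" "sat M u \<chi>" "\<not> sat M u \<psi>" by (auto simp: entails_def)
    then obtain v where v: "v \<in> assignments M" "sat M v \<phi>" "\<And>i. i < n \<Longrightarrow> u i = tval M v (ts ! i)"
      using \<chi>(2) by blast
    have "fvars \<psi> \<subseteq> {..<n}" using p \<psi>(1) by (auto simp: formulas_def)
    then have "sat M (\<lambda>i. tval M v (ts ! i)) \<psi> \<longleftrightarrow> sat M u \<psi>"
      by (intro sat_cong) (use v(3) in force)
    then have "sat M v (Neg (fsubst (\<lambda>i. ts ! i) \<psi>))" using u(3) by (simp add: sat_fsubst)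
    moreover have "fsubst (\<lambda>i. ts ! i) \<psi> \<in> formulas L UNIV"
      using p \<psi>(1) ts by (intro fsubst_in_formulas) (auto simp: formulas_def)
    ultimately show "\<exists>\<xi> \<in> E ts \<inter> formulas L UNIV. satisfiable_in M (Conj \<phi> \<xi>)"
      using v(1,2) \<psi>(1)
      by (intro bexI[of _ "Neg (fsubst (\<lambda>i. ts ! i) \<psi>)"]) (auto simp: E_def satisfiable_in_def formulas_def)
  qed
  have wit: "\<exists>\<tau> \<in> terms L UNIV. satisfiable_in M (Conj \<phi> (instance_of \<psi> j \<tau>))"
    if sat: "satisfiable_in M (Conj \<phi> (Ex j \<psi>))" for \<phi> j \<psi>
  proof -
    obtain s x where s: "s \<in> assignments M" "sat M s \<phi>" "x \<in> Dom M" "sat M (s(j := x)) \<psi>"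
      using sat by (auto simp: satisfiable_in_def)
    \<comment> \<open>A variable outside the condition and the formula can take the value of the witness.\<close>
    define k where "k = fresh (fvars \<phi> \<union> fvars \<psi>)"
    have k: "k \<notin> fvars \<phi> \<union> fvars \<psi>" unfolding k_def by (rule fresh) (simp add: finite_fvars)
    have "sat M (s(k := x)) \<phi> \<longleftrightarrow> sat M s \<phi>" by (rule sat_cong) (use k in auto)
    moreover have "sat M (s(k := x, j := x)) \<psi> \<longleftrightarrow> sat M (s(j := x)) \<psi>"
      by (rule sat_cong) (use k in auto)
    ultimately have "sat M (s(k := x)) (Conj \<phi> (instance_of \<psi> j (Var k)))"
      using s by (simp add: sat_instance_of)
    then show ?thesis using assignments_upd[OF s(1,3), of k]
      by (intro bexI[of _ "Var k"]) (auto simp: satisfiable_in_def terms_def simp del: sat.simps)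
  qed
  have "assignments M \<noteq> {}" using assignment_of_tuple[OF M, of "[]" 0] by (auto simp: tuples_def)
  then have \<theta>: "\<theta> \<in> formulas L UNIV" "satisfiable_in M \<theta>"
    by (auto simp: \<theta>_def formulas_def satisfiable_in_def)
  have "\<exists>F. generic L M UNIV F \<and>
      (\<forall>D \<in> E ` TS. \<exists>\<psi> \<in> D \<inter> formulas L UNIV. \<forall>\<^sub>F s in F. sat M s \<psi>)"
    by (rule generic_exists[OF L _ _ \<theta>]) (use \<open>countable TS\<close> E wit in auto)
  then obtain F where F: "generic L M UNIV F"
    and omit: "\<forall>D \<in> E ` TS. \<exists>\<psi> \<in> D \<inter> formulas L UNIV. \<forall>\<^sub>F s in F. sat M s \<psi>"
    by blast
  obtain N :: "('v, 'f, 'r) struct" and h where N: "is_struct L N" "Dom N = h ` terms L UNIV"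
    "\<And>\<sigma> \<phi>. range \<sigma> \<subseteq> terms L UNIV \<Longrightarrow> is_formula L \<phi> \<Longrightarrow>
      sat N (h \<circ> \<sigma>) \<phi> \<longleftrightarrow> (\<forall>\<^sub>F s in F. sat M (\<lambda>i. tval M s (\<sigma> i)) \<phi>)"
    "\<And>\<phi>. is_formula L \<phi> \<Longrightarrow> models_sentence M \<phi> \<Longrightarrow> models_sentence N \<phi>"
    by (rule term_model[OF L M F]) auto
  show thesis
  proof (rule that)
    show "is_model L (Th L M) N" using N(1,4) by (auto simp: is_model_def Th_def is_sentence_def)
  next
    fix s assume "s \<in> assignments N"
    then obtain \<sigma> where \<sigma>: "range \<sigma> \<subseteq> terms L UNIV" "s = h \<circ> \<sigma>"
      using N(2) by (rule lift_assignment)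
    then have "map \<sigma> [0..<n] \<in> TS" by (auto simp: TS_def image_subset_iff)
    then obtain \<psi> where \<psi>: "\<psi> \<in> p" "\<forall>\<^sub>F s in F. \<not> sat M s (fsubst (\<lambda>i. map \<sigma> [0..<n] ! i) \<psi>)"
      using omit by (fastforce simp: E_def)
    have "fvars \<psi> \<subseteq> {..<n}" using p \<psi>(1) by (auto simp: formulas_def)
    then have "sat M s (fsubst (\<lambda>i. map \<sigma> [0..<n] ! i) \<psi>) \<longleftrightarrow> sat M (\<lambda>i. tval M s (\<sigma> i)) \<psi>" for s
      unfolding sat_fsubst by (intro sat_cong) auto
    then have "\<forall>\<^sub>F s in F. sat M (\<lambda>i. tval M s (\<sigma> i)) (Neg \<psi>)" using \<psi>(2) by simp
    moreover have "is_formula L (Neg \<psi>)" using p \<psi>(1) by (auto simp: formulas_def)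
    ultimately have "sat N s (Neg \<psi>)" using N(3)[OF \<sigma>(1)] \<sigma>(2) by blast
    then show "\<exists>\<psi> \<in> p. \<not> sat N s \<psi>" using \<psi>(1) by auto
  qed
qed

text \<open>
  A type that is not isolated is omitted in some model of the theory of \<open>M\<close>, but an elementary
  embedding of \<open>M\<close> into that model carries a realisation along.
\<close>

lemma prime_isolates:
  fixes M :: "('u, 'f, 'r) struct"
  assumes L: "countable_lang L" and M: "is_struct L M" "prime_model TYPE('v::infinite) L M"
    and g: "g \<in> assignments M"
  obtains \<phi> where "complete_formula L M n \<phi>" "sat M g \<phi>"
proof -
  define p where "p = {\<psi> \<in> formulas L {..<n}. sat M g \<psi>}"
  have "\<exists>\<phi>. \<phi> \<in> formulas L {..<n} \<and> satisfiable_in M \<phi> \<and> (\<forall>\<psi> \<in> p. entails M \<phi> \<psi>)"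
  proof (rule ccontr)
    assume noniso: "\<not> ?thesis"
    obtain N :: "('v, 'f, 'r) struct" where N: "is_model L (Th L M) N"
      "\<And>s. s \<in> assignments N \<Longrightarrow> \<exists>\<psi> \<in> p. \<not> sat N s \<psi>"
      by (rule omitting_non_isolated_type[OF L M(1), of p n]) (use noniso in \<open>auto simp: p_def\<close>)
    then obtain h where h: "elementary_embedding L M N h" using M(2) by (auto simp: prime_model_def)
    then have "h \<circ> g \<in> assignments N"
      using assignmentsD[OF g] by (auto simp: elementary_embedding_def assignments_def)
    then obtain \<psi> where "\<psi> \<in> p" "\<not> sat N (h \<circ> g) \<psi>" using N(2) by blast
    then show False
      using h g by (auto simp: p_def formulas_def elementary_embedding_def assignments_def)
  qed
  then obtain \<phi> where \<phi>: "\<phi> \<in> formulas L {..<n}" "satisfiable_in M \<phi>"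
    "\<And>\<psi>. \<psi> \<in> p \<Longrightarrow> entails M \<phi> \<psi>" by blast
  have p: "\<psi> \<in> p \<or> Neg \<psi> \<in> p" if "\<psi> \<in> formulas L {..<n}" for \<psi>
    using that by (auto simp: p_def formulas_def)
  then have "complete_formula L M n \<phi>" using \<phi> by (auto simp: complete_formula_def)
  moreover have "\<not> entails M \<phi> (Neg \<phi>)" using \<phi>(2) by (auto simp: entails_def satisfiable_in_def)
  then have "sat M g \<phi>" using p[OF \<phi>(1)] \<phi>(3) by (auto simp: p_def)
  ultimately show thesis using that by blast
qed

text \<open>
  The property of being a generating tuple depends only on an isolated type: with \<open>b = \<sigma>(g)\<close>, some
  \<open>g'\<close> of the same type satisfies \<open>g = \<sigma>(g')\<close>; and \<open>g' = \<rho>(g)\<close> makes \<open>x = \<rho>(\<sigma>(x))\<close> true of \<open>g'\<close>,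
  hence of \<open>g\<close>.
\<close>

lemma complete_formula_spans:
  fixes M :: "('u, 'f, 'r) struct"
  assumes \<phi>: "complete_formula L M n \<phi>"
    and g: "g \<in> assignments M" "sat M g \<phi>" "spans L M n g"
    and b: "b \<in> assignments M" "sat M b \<phi>"
  shows "spans L M n b"
proof -
  note same = complete_formula_same_type[OF \<phi>]
  have \<phi>': "is_formula L \<phi>" using \<phi> by (simp add: complete_formula_def formulas_def)
  obtain \<sigma> where \<sigma>: "range \<sigma> \<subseteq> terms L {..<n}" "\<And>i. b i = tval M g (\<sigma> i)"
    using spans_assignment[OF g(3) b(1)] by blast
  obtain \<chi> where \<chi>: "\<chi> \<in> formulas L {..<n}"
    "\<And>(M :: ('u, 'f, 'r) struct) s. s \<in> assignments M \<Longrightarrow> sat M s \<chi> \<longleftrightarrow>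
      (\<exists>s' \<in> assignments M. sat M s' \<phi> \<and> (\<forall>i < n. s i = tval M s' (\<sigma> i)))"
    by (rule image_definable[OF \<phi>', of n \<sigma>]) (use \<sigma>(1) in \<open>auto simp: terms_def image_subset_iff\<close>)
  have "sat M b \<chi>" using \<chi>(2)[OF b(1)] g(1,2) \<sigma>(2) by blast
  then have "sat M g \<chi>" using same[OF \<chi>(1) g(1,2) b] by blast
  then obtain g' where g': "g' \<in> assignments M" "sat M g' \<phi>" "\<And>i. i < n \<Longrightarrow> g i = tval M g' (\<sigma> i)"
    using \<chi>(2)[OF g(1)] by blast
  obtain \<rho> where \<rho>: "range \<rho> \<subseteq> terms L {..<n}" "\<And>i. g' i = tval M g (\<rho> i)"
    using spans_assignment[OF g(3) g'(1)] by blast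
  have g'_fix: "g' i = tval M g' (tsubst \<sigma> (\<rho> i))" for i
  proof -
    have "tval M g (\<rho> i) = tval M (\<lambda>k. tval M g' (\<sigma> k)) (\<rho> i)"
      by (rule tval_cong) (use g'(3) \<rho>(1) in \<open>force simp: terms_def\<close>)
    then show ?thesis using \<rho>(2) by (simp add: tval_tsubst)
  qed
  have "g i = tval M b (\<rho> i)" if "i < n" for i
  proof -
    have "tsubst \<sigma> (\<rho> i) \<in> terms L {..<n}"
      using \<sigma>(1) \<rho>(1) by (intro tsubst_in_terms) (auto simp: terms_def image_subset_iff)
    then have "Eq (Var i) (tsubst \<sigma> (\<rho> i)) \<in> formulas L {..<n}"
      using that by (auto simp: formulas_def terms_def)
    moreover have "sat M g' (Eq (Var i) (tsubst \<sigma> (\<rho> i)))"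
      using g'_fix by simp
    ultimately have "sat M g (Eq (Var i) (tsubst \<sigma> (\<rho> i)))"
      using same[of _ g' g] g g' by blast
    moreover have "tval M g (tsubst \<sigma> (\<rho> i)) = tval M b (\<rho> i)"
      unfolding tval_tsubst using \<sigma>(2) by (intro tval_cong) simp
    ultimately show ?thesis by simp
  qed
  then show ?thesis using \<rho>(1) by (intro spans_trans[OF g(3), of b \<rho>]) auto
qed

section \<open>Generated models that avoid countably many types\<close>

text \<open>
  As no condition is complete, every condition is consistent with both \<open>\<psi>\<close> and \<open>\<not> \<psi>\<close> for some \<open>\<psi>\<close>,
  one of which differs from the given complete type \<open>p\<close>: avoiding \<open>p\<close> is dense. An existential
  formula true of a tuple satisfying \<open>\<theta>\<close> has a witness in \<open>M\<close>, which is a term in the tuple as the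
  tuple generates \<open>M\<close>: this is the Henkin property with \<open>n\<close> variables. In the resulting model the
  classes of the \<open>n\<close> variables generate.
\<close>

lemma new_generated_model:
  fixes L :: "('f, 'r) lang" and M :: "('u, 'f, 'r) struct"
  assumes L: "countable_lang L" and M: "is_struct L M" and n: "n \<ge> 1"
    and \<theta>: "\<theta> \<in> formulas L {..<n}" "satisfiable_in M \<theta>"
    and spans: "\<And>s. s \<in> assignments M \<Longrightarrow> sat M s \<theta> \<Longrightarrow> spans L M n s"
    and incomplete: "\<And>\<phi>. complete_formula L M n \<phi> \<Longrightarrow> \<not> entails M \<phi> \<theta>"
    and P: "countable P" "\<And>p \<psi>. p \<in> P \<Longrightarrow> \<psi> \<in> p \<or> Neg \<psi> \<in> p"
  obtains N :: "('v::infinite, 'f, 'r) struct" and c where "is_model L (Th L M) N"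
    "c \<in> assignments N" "spans L N n c" "\<And>p. p \<in> P \<Longrightarrow> \<exists>\<psi> \<in> p \<inter> formulas L {..<n}. \<not> sat N c \<psi>"
proof -
  let ?V = "{..<n}"
  define avoid :: "('f, 'r) fm set \<Rightarrow> ('f, 'r) fm set" where "avoid p = Neg ` (p \<inter> formulas L ?V)" for p
  have avoid: "dense_below L M ?V \<theta> (avoid p)" if "p \<in> P" for p
    unfolding dense_below_def
  proof (intro ballI impI)
    fix \<phi> assume \<phi>: "\<phi> \<in> formulas L ?V" "satisfiable_in M \<phi> \<and> entails M \<phi> \<theta>"
    then have "\<not> complete_formula L M n \<phi>" using incomplete by blast
    then obtain \<psi> where \<psi>: "\<psi> \<in> formulas L ?V" "\<not> entails M \<phi> \<psi>" "\<not> entails M \<phi> (Neg \<psi>)"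
      using \<phi> by (auto simp: complete_formula_def)
    show "\<exists>\<xi> \<in> avoid p \<inter> formulas L ?V. satisfiable_in M (Conj \<phi> \<xi>)"
    proof (cases "\<psi> \<in> p")
      case True
      then show ?thesis using \<psi>
        by (intro bexI[of _ "Neg \<psi>"]) (auto simp: avoid_def entails_def satisfiable_in_def formulas_def)
    next
      case False
      then have "Neg \<psi> \<in> p" using P(2) that by blast
      then show ?thesis using \<psi>
        by (intro bexI[of _ "Neg (Neg \<psi>)"])
          (auto simp: avoid_def entails_def satisfiable_in_def formulas_def)
    qed
  qed
  have wit: "\<exists>\<tau> \<in> terms L ?V. satisfiable_in M (Conj \<phi> (instance_of \<psi> j \<tau>))"
    if "entails M \<phi> \<theta>" and sat: "satisfiable_in M (Conj \<phi> (Ex j \<psi>))" for \<phi> j \<psi>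
  proof -
    obtain s x where s: "s \<in> assignments M" "sat M s \<phi>" "x \<in> Dom M" "sat M (s(j := x)) \<psi>"
      using sat by (auto simp: satisfiable_in_def)
    then have "spans L M n s" using spans that(1) by (auto simp: entails_def)
    then obtain \<tau> where "\<tau> \<in> terms L ?V" "x = tval M s \<tau>" using s(3) by (auto simp: spans_def)
    then show ?thesis using s
      by (intro bexI[of _ \<tau>]) (auto simp: satisfiable_in_def sat_instance_of)
  qed
  have "\<exists>F. generic L M ?V F \<and>
      (\<forall>D \<in> avoid ` P. \<exists>\<psi> \<in> D \<inter> formulas L ?V. \<forall>\<^sub>F s in F. sat M s \<psi>)"
    by (rule generic_exists[OF L _ _ \<theta>]) (use P(1) avoid wit in auto)
  then obtain F where F: "generic L M ?V F"
    and new: "\<forall>D \<in> avoid ` P. \<exists>\<psi> \<in> D \<inter> formulas L ?V. \<forall>\<^sub>F s in F. sat M s \<psi>"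
    by blast
  have "?V \<noteq> {}" using n by (auto simp: lessThan_empty_iff)
  then obtain N :: "('v, 'f, 'r) struct" and h where N: "is_struct L N" "Dom N = h ` terms L ?V"
    "\<And>\<sigma> \<phi>. range \<sigma> \<subseteq> terms L ?V \<Longrightarrow> is_formula L \<phi> \<Longrightarrow>
      sat N (h \<circ> \<sigma>) \<phi> \<longleftrightarrow> (\<forall>\<^sub>F s in F. sat M (\<lambda>i. tval M s (\<sigma> i)) \<phi>)"
    "\<And>\<sigma> t. range \<sigma> \<subseteq> terms L ?V \<Longrightarrow> is_term L t \<Longrightarrow> tval N (h \<circ> \<sigma>) t = h (tsubst \<sigma> t)"
    "\<And>\<phi>. is_formula L \<phi> \<Longrightarrow> models_sentence M \<phi> \<Longrightarrow> models_sentence N \<phi>"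
    using term_model[OF L M F] by metis
  \<comment> \<open>The tuple of variables as a substitution; its entries from \<open>n\<close> onwards only have to be terms.\<close>
  define x where "x i = (if i < n then Var i else Var 0 :: 'f tm)" for i
  have x: "range x \<subseteq> terms L ?V" using n by (auto simp: x_def terms_def)
  show thesis
  proof (rule that)
    show "is_model L (Th L M) N" using N(1,5) by (auto simp: is_model_def Th_def is_sentence_def)
    show "h \<circ> x \<in> assignments N" using N(2) x by (auto simp: assignments_def)
    have "tval N (h \<circ> x) \<tau> = h \<tau>" if "\<tau> \<in> terms L ?V" for \<tau>
    proof -
      have "tsubst x \<tau> = \<tau>" using that by (intro tsubst_Var) (auto simp: x_def terms_def)
      then show ?thesis using N(4)[OF x, of \<tau>] that by (simp add: terms_def)
    qed
    then show "spans L N n (h \<circ> x)" using N(2) by (fastforce simp: spans_def)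
  next
    fix p assume "p \<in> P"
    then obtain \<psi> where \<psi>: "\<psi> \<in> p \<inter> formulas L ?V" "\<forall>\<^sub>F s in F. sat M s (Neg \<psi>)"
      using new by (auto simp: avoid_def)
    have "fvars \<psi> \<subseteq> {..<n}" using \<psi>(1) by (simp add: formulas_def)
    then have "sat M (\<lambda>i. tval M s (x i)) (Neg \<psi>) \<longleftrightarrow> sat M s (Neg \<psi>)" for s
      by (intro sat_cong) (auto simp: x_def)
    then have "sat N (h \<circ> x) (Neg \<psi>)" using \<psi> N(3)[OF x, of "Neg \<psi>"] by (simp add: formulas_def)
    then show "\<exists>\<psi> \<in> p \<inter> formulas L ?V. \<not> sat N (h \<circ> x) \<psi>" using \<psi>(1) by auto
  qed
qed

section \<open>Counting the types of tuples in generated models\<close>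

lemma tval_isomorphism:
  assumes M: "is_struct L M" and h: "is_isomorphism L M N h" and s: "s \<in> assignments M"
    and t: "is_term L t"
  shows "tval N (h \<circ> s) t = h (tval M s t)"
  using t
proof (induction t)
  case (App f ts)
  have "map (tval M s) ts \<in> tuples M (farity L f)"
    using App.prems by (auto simp: tuples_def intro!: tval_in_Dom[OF M _ s])
  then have "h (tval M s (App f ts)) = fint N f (map h (map (tval M s) ts))"
    using h App.prems by (simp add: is_isomorphism_def)
  moreover have "map h (map (tval M s) ts) = map (tval N (h \<circ> s)) ts"
    using App by (simp add: comp_def)
  ultimately show ?case by (simp only: tval.simps)
qed simp

lemma sat_isomorphism:
  assumes M: "is_struct L M" and h: "is_isomorphism L M N h"
    and "s \<in> assignments M" "is_formula L \<phi>"
  shows "sat N (h \<circ> s) \<phi> \<longleftrightarrow> sat M s \<phi>"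
  using assms(3,4)
proof (induction \<phi> arbitrary: s)
  case (Eq t u)
  have "inj_on h (Dom M)" using h by (auto simp: is_isomorphism_def bij_betw_def)
  moreover have "tval M s t \<in> Dom M" "tval M s u \<in> Dom M"
    using Eq by (auto intro!: tval_in_Dom[OF M])
  moreover have "tval N (h \<circ> s) t = h (tval M s t)" "tval N (h \<circ> s) u = h (tval M s u)"
    using Eq by (auto intro!: tval_isomorphism[OF M h])
  ultimately show ?case by (simp only: sat.simps inj_on_eq_iff)
next
  case (Rel r ts)
  have "map (tval M s) ts \<in> tuples M (rarity L r)"
    using Rel.prems by (auto simp: tuples_def intro!: tval_in_Dom[OF M])
  then have "rint M r (map (tval M s) ts) \<longleftrightarrow> rint N r (map h (map (tval M s) ts))"
    using h Rel.prems(2) by (auto simp: is_isomorphism_def)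
  moreover have "tval N (h \<circ> s) t = h (tval M s t)" if "t \<in> set ts" for t
    using Rel.prems that by (intro tval_isomorphism[OF M h]) auto
  then have "map (tval N (h \<circ> s)) ts = map h (map (tval M s) ts)" by (simp add: comp_def)
  ultimately show ?case by (simp only: sat.simps)
next
  case (Ex i \<phi>)
  have Dom: "Dom N = h ` Dom M" using h by (auto simp: is_isomorphism_def bij_betw_def)
  have "sat N ((h \<circ> s)(i := h x)) \<phi> \<longleftrightarrow> sat M (s(i := x)) \<phi>" if "x \<in> Dom M" for x
  proof -
    have "(h \<circ> s)(i := h x) = h \<circ> (s(i := x))" by auto
    moreover have "sat N (h \<circ> (s(i := x))) \<phi> \<longleftrightarrow> sat M (s(i := x)) \<phi>"
      using Ex.prems(2) by (intro Ex.IH assignments_upd[OF Ex.prems(1) that]) simp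
    ultimately show ?thesis by (simp only:)
  qed
  then show ?case unfolding sat.simps Dom by blast
qed auto

lemma countable_Dom:
  assumes "countable_lang L" "generates L M a"
  shows "countable (Dom M)"
proof -
  have "Dom M \<subseteq> tval M (asg a) ` terms L UNIV"
    using assms(2) by (fastforce simp: generates_def terms_def)
  then show ?thesis using countable_terms[OF assms(1)] by (meson countable_image countable_subset)
qed

lemma iso_rel_refl: "is_struct L M \<Longrightarrow> (M, M) \<in> iso_rel L"
  by (auto simp: iso_rel_def is_isomorphism_def intro!: exI[of _ id])

text \<open>
  Isomorphic models realise the same types, so one representative of each isomorphism class suffices,
  and each representative is countable because it is generated by a finite tuple.
\<close>

lemma countable_types:
  assumes L: "countable_lang L" and \<alpha>: "alpha TYPE('u::infinite) L n T \<le>o natLeq"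
  obtains P where "countable P" "\<And>p \<psi>. p \<in> P \<Longrightarrow> \<psi> \<in> p \<or> Neg \<psi> \<in> p"
    "\<And>(N :: ('u, 'f, 'r) struct) c. N \<in> n_gen_models L T n \<Longrightarrow> c \<in> assignments N \<Longrightarrow>
      \<exists>p \<in> P. \<forall>\<psi> \<in> p \<inter> formulas L {..<n}. sat N c \<psi>"
proof -
  define Q where "Q = (n_gen_models L T n :: ('u, 'f, 'r) struct set) // iso_rel L"
  define rep where "rep C = (SOME N. N \<in> C \<and> N \<in> n_gen_models L T n)" for C :: "('u, 'f, 'r) struct set"
  define P where "P = (\<Union>C \<in> Q. (\<lambda>a. {\<psi>. sat (rep C) (asg a) \<psi>}) ` lists (Dom (rep C)))"
  have "countable Q" using \<alpha> by (simp add: alpha_def Q_def countable_card_le_natLeq)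
  have ex: "\<exists>N. N \<in> C \<and> N \<in> n_gen_models L T n" if "C \<in> Q" for C
  proof -
    obtain N where N: "N \<in> n_gen_models L T n" "C = iso_rel L `` {N}"
      using \<open>C \<in> Q\<close> unfolding Q_def by (rule quotientE)
    moreover have "(N, N) \<in> iso_rel L"
      using N(1) by (intro iso_rel_refl) (simp add: n_gen_models_def is_model_def)
    ultimately show ?thesis by blast
  qed
  have rep: "rep C \<in> C \<and> rep C \<in> n_gen_models L T n" if "C \<in> Q" for C
    using someI_ex[OF ex[OF that]] by (simp only: rep_def)
  show thesis
  proof (rule that)
    show "countable P"
      unfolding P_def
      using rep by (intro countable_UN[OF \<open>countable Q\<close>] countable_image countable_lists)
        (auto simp: n_gen_models_def n_generated_def intro: countable_Dom[OF L])
    show "\<psi> \<in> p \<or> Neg \<psi> \<in> p" if "p \<in> P" for p \<psi>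
      using that by (auto simp: P_def)
  next
    fix N :: "('u, 'f, 'r) struct" and c assume N: "N \<in> n_gen_models L T n" "c \<in> assignments N"
    define C where "C = iso_rel L `` {N}"
    have C: "C \<in> Q" using N(1) by (simp add: C_def Q_def quotientI)
    then have "(N, rep C) \<in> iso_rel L" using rep by (auto simp: C_def)
    then obtain h where h: "is_struct L N" "is_isomorphism L N (rep C) h" by (auto simp: iso_rel_def)
    define a where "a = map (h \<circ> c) [0..<n]"
    have "h \<circ> c \<in> assignments (rep C)"
      using h(2) assignmentsD[OF N(2)] by (auto simp: assignments_def is_isomorphism_def bij_betw_def)
    note a = tuple_of_assignment[OF this, where n = n, folded a_def]
    have "sat N c \<psi>" if "sat (rep C) (asg a) \<psi>" "\<psi> \<in> formulas L {..<n}" for \<psi>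
    proof -
      have \<psi>: "is_formula L \<psi>" "fvars \<psi> \<subseteq> {..<n}" using that(2) by (auto simp: formulas_def)
      then have "sat (rep C) (h \<circ> c) \<psi>" using sat_asg_iff[OF a \<psi>(2)] that(1) by blast
      then show ?thesis using sat_isomorphism[OF h N(2) \<psi>(1)] by blast
    qed
    moreover have "{\<psi>. sat (rep C) (asg a) \<psi>} \<in> P"
      using C a(1) by (auto simp: P_def tuples_def)
    ultimately show "\<exists>p \<in> P. \<forall>\<psi> \<in> p \<inter> formulas L {..<n}. sat N c \<psi>" by blast
  qed
qed

text \<open>
  Otherwise there would be an \<open>n\<close>-generated model of \<open>T\<close> with a tuple whose type differs from all
  the countably many types realised in \<open>n\<close>-generated models of \<open>T\<close>.
\<close>

lemma complete_formula_below:
  fixes M :: "('u::infinite, 'f, 'r) struct"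
  assumes L: "countable_lang L" and n: "n \<ge> 1" and T: "complete_theory TYPE('u) L T"
    and \<alpha>: "alpha TYPE('u) L n T \<le>o natLeq" and M: "is_model L T M"
    and \<theta>: "\<theta> \<in> formulas L {..<n}" "satisfiable_in M \<theta>"
    and spans: "\<And>s. s \<in> assignments M \<Longrightarrow> sat M s \<theta> \<Longrightarrow> spans L M n s"
  obtains \<phi> where "complete_formula L M n \<phi>" "entails M \<phi> \<theta>"
proof (rule ccontr)
  assume none: "\<not> thesis"
  have none': "\<not> entails M \<phi> \<theta>" if "complete_formula L M n \<phi>" for \<phi>
    using none \<open>\<And>\<phi>. complete_formula L M n \<phi> \<Longrightarrow> entails M \<phi> \<theta> \<Longrightarrow> thesis\<close> that by blast
  have M': "is_struct L M" using M by (simp add: is_model_def)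
  obtain P where P: "countable P" "\<And>p \<psi>. p \<in> P \<Longrightarrow> \<psi> \<in> p \<or> Neg \<psi> \<in> p"
    "\<And>(N :: ('u, 'f, 'r) struct) c. N \<in> n_gen_models L T n \<Longrightarrow> c \<in> assignments N \<Longrightarrow>
      \<exists>p \<in> P. \<forall>\<psi> \<in> p \<inter> formulas L {..<n}. sat N c \<psi>"
    using countable_types[OF L \<alpha>] by blast
  obtain N :: "('u, 'f, 'r) struct" and c where N: "is_model L (Th L M) N" "c \<in> assignments N"
    "spans L N n c" "\<And>p. p \<in> P \<Longrightarrow> \<exists>\<psi> \<in> p \<inter> formulas L {..<n}. \<not> sat N c \<psi>"
    by (rule new_generated_model[OF L M' n \<theta> spans none' P(1,2)]) blast+
  have "T \<subseteq> Th L M" using T M by (auto simp: complete_theory_def Th_def is_model_def)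
  then have "is_model L T N" using N(1) by (auto simp: is_model_def)
  moreover have "n_generated L n N"
    using generates_iff_spans[OF tuple_of_assignment[OF N(2)]] tuple_of_assignment[OF N(2)] N(3)
    by (auto simp: n_generated_def)
  ultimately show False using P(3)[of N c] N(2,4) by (auto simp: n_gen_models_def)
qed

section \<open>Characterisation of prime generated models\<close>

theorem theorem4p5:
  fixes L :: "('f, 'r) lang"
    and n :: nat
    and T :: "('f, 'r) fm set"
    and M :: "('u::infinite, 'f, 'r) struct"
  assumes "countable_lang L"
    and "n \<ge> 1"
    and "complete_theory TYPE('u) L T"
    and "alpha TYPE('u) L n T \<le>o natLeq"
    and "is_model L T M"
    and "n_generated L n M"
  shows "prime_model TYPE('v::infinite) L M \<longleftrightarrow>
    (\<exists>m \<theta>. is_formula L \<theta> \<and> fvars \<theta> \<subseteq> {..<m} \<and>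
       (\<exists>a \<in> tuples M m. sat M (asg a) \<theta>) \<and>
       (\<forall>a \<in> tuples M m. sat M (asg a) \<theta> \<longrightarrow> generates L M a))"
proof -
  have M: "is_struct L M" using assms(5) by (simp add: is_model_def)
  obtain a where a: "a \<in> tuples M n" "generates L M a" using assms(6) by (auto simp: n_generated_def)
  obtain g where g: "g \<in> assignments M" "\<And>i. i < n \<Longrightarrow> g i = a ! i"
    using assignment_of_tuple[OF M a(1)] by blast
  have g_spans: "spans L M n g" using generates_iff_spans[OF a(1) g(2)] a(2) by simp
  show ?thesis
  proof
    assume "prime_model TYPE('v) L M"
    then obtain \<phi> where \<phi>: "complete_formula L M n \<phi>" "sat M g \<phi>"
      using prime_isolates[OF assms(1) M _ g(1), of n] by blast
    then have \<phi>': "is_formula L \<phi>" "fvars \<phi> \<subseteq> {..<n}" by (auto simp: complete_formula_def formulas_def)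
    have "generates L M b" if b: "b \<in> tuples M n" "sat M (asg b) \<phi>" for b
    proof -
      obtain s where s: "s \<in> assignments M" "\<And>i. i < n \<Longrightarrow> s i = b ! i"
        using assignment_of_tuple[OF M b(1)] by blast
      then have "sat M s \<phi>" using sat_asg_iff[OF b(1) s(2) \<phi>'(2)] b(2) by blast
      then have "spans L M n s" using complete_formula_spans[OF \<phi>(1) g(1) \<phi>(2) g_spans s(1)] by blast
      then show ?thesis using generates_iff_spans[OF b(1) s(2)] by blast
    qed
    moreover have "sat M (asg a) \<phi>" using sat_asg_iff[OF a(1) g(2) \<phi>'(2)] \<phi>(2) by blast
    ultimately show "\<exists>m \<theta>. is_formula L \<theta> \<and> fvars \<theta> \<subseteq> {..<m} \<and>
       (\<exists>a \<in> tuples M m. sat M (asg a) \<theta>) \<and>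
       (\<forall>a \<in> tuples M m. sat M (asg a) \<theta> \<longrightarrow> generates L M a)"
      using \<phi>' a(1) by blast
  next
    assume "\<exists>m \<theta>. is_formula L \<theta> \<and> fvars \<theta> \<subseteq> {..<m} \<and>
       (\<exists>a \<in> tuples M m. sat M (asg a) \<theta>) \<and>
       (\<forall>a \<in> tuples M m. sat M (asg a) \<theta> \<longrightarrow> generates L M a)"
    then obtain m \<theta> b where \<theta>: "is_formula L \<theta>" "fvars \<theta> \<subseteq> {..<m}"
      "\<And>a. a \<in> tuples M m \<Longrightarrow> sat M (asg a) \<theta> \<Longrightarrow> generates L M a"
      and b: "b \<in> tuples M m" "sat M (asg b) \<theta>" by blast
    obtain s where s: "s \<in> assignments M" "\<And>i. i < m \<Longrightarrow> s i = b ! i"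
      using assignment_of_tuple[OF M b(1)] by blast
    \<comment> \<open>With \<open>b = \<sigma>(g)\<close>, the formula \<open>\<theta>(\<sigma>(y))\<close> in \<open>n\<close> variables holds of \<open>g\<close>, and any tuple \<open>y\<close> that
      satisfies it generates \<open>M\<close>, as \<open>\<sigma>(y)\<close> already does.\<close>
    obtain \<sigma> where \<sigma>: "range \<sigma> \<subseteq> terms L {..<n}" "\<And>i. s i = tval M g (\<sigma> i)"
      using spans_assignment[OF g_spans s(1)] by blast
    have "sat M (\<lambda>i. tval M g (\<sigma> i)) \<theta>"
      using sat_asg_iff[OF b(1) s(2) \<theta>(2), where N = M] b(2) \<sigma>(2) by simp
    then have 1: "satisfiable_in M (fsubst \<sigma> \<theta>)" using g(1) by (auto simp: satisfiable_in_def sat_fsubst)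
    have 2: "spans L M n u" if u: "u \<in> assignments M" "sat M u (fsubst \<sigma> \<theta>)" for u
    proof -
      let ?w = "\<lambda>i. tval M u (\<sigma> i)"
      have "?w \<in> assignments M"
        using \<sigma>(1) by (auto simp: assignments_def terms_def intro!: tval_in_Dom[OF M _ u(1)])
      note w = tuple_of_assignment[OF this, where n = m]
      have "spans L M m ?w"
        using \<theta>(3)[OF w(1)] sat_asg_iff[OF w \<theta>(2), of M] generates_iff_spans[OF w] u(2)
        by (simp add: sat_fsubst)
      then show ?thesis by (rule spans_trans) (use \<sigma>(1) in auto)
    qed
    obtain \<phi> where \<phi>: "complete_formula L M n \<phi>" "entails M \<phi> (fsubst \<sigma> \<theta>)"
      using complete_formula_below[OF assms(1-5) _ 1 2] fsubst_in_formulas[OF \<theta>(1)] \<sigma>(1) by blast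
    then obtain u where u: "u \<in> assignments M" "sat M u \<phi>"
      by (auto simp: complete_formula_def satisfiable_in_def)
    then show "prime_model TYPE('v) L M"
      using prime_if_complete_formula[OF M \<phi>(1) u] 2[OF u(1)] \<phi>(2) by (auto simp: entails_def)
  qed
qed

end
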